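(* Fix constants $0<\tau,c\le1$. For every $\varepsilon_0\in(0,\frac12)$ there exists a set $E\subseteq[0,1]$ with $\dim_{\mathbb F}(E)=\frac1{1+\tau}$ such that $E$ contains no nontrivial solution of $$tx+(1-t)y=z\quad\text{for any } t\in\mathcal E_{c,\tau}\cap(\varepsilon_0,1-\varepsilon_0);$$ that is, for no such $t$ do there exist pairwise distinct $x,y,z\in E$ with $tx+(1-t)y=z$.
   Context: $\mathbb N=\{1,2,\ldots\}$. For $0<\tau,c\le1$, $$\mathcal E_{c,\tau}:=\Bigl\{t\in(0,1): \Bigl|t-\frac qp\Bigr|>\frac c{p^{1+\tau}}\text{ for all } p\in\mathbb N,\ q\in\mathbb Z \text{ with }\gcd(p,q)=1\Bigr\}.$$ A solution $(x,y,z)$ of the equation is nontrivial if its entries are all distinct. The Fourier transform of a measure $\mu$ is $\widehat\mu(\xi)=\int e^{-ix\xi}\,d\mu(x)$. The Fourier dimension $\dim_{\mathbb F}(A)$ of a Borel set $A\subseteq\mathbb R$ is the supremum of exponents $\beta\le 1$ for which there exist a probability measure $\mu$ supported on $A$ and a finite constant $C_2>0$ with $|\widehat\mu(\xi)|\le C_2(1+|\xi|)^{-\beta/2}$ for all $\xi\in\mathbb R$. *)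

theory Defs
  imports "HOL-Probability.Probability"
begin

definition badly_approx :: "real \<Rightarrow> real \<Rightarrow> real set" where
  "badly_approx c \<tau> =
     {t \<in> {0<..<1}. \<forall>(p::nat) (q::int). p \<ge> 1 \<and> coprime (int p) q \<longrightarrow>
        \<bar>t - of_int q / of_nat p\<bar> > c / of_nat p powr (1 + \<tau>)}"

(* The sign and normalisation differ from the library's characteristic function
   char, which integrates exp(+i x xi). *)
definition fourier_transform :: "real measure \<Rightarrow> real \<Rightarrow> complex" where
  "fourier_transform M \<xi> = (CLINT x|M. exp (- (\<i> * of_real x * of_real \<xi>)))"

(* Only meaningful for Borel sets A.  "Supported on A" means that the Borel probability
   measure M gives A full mass.  The supremum is taken in the extended reals, so it is
   well defined for every A (it is minus infinity for the empty set, which carries no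
   probability measure). *)
definition fourier_dim :: "real set \<Rightarrow> ereal" where
  "fourier_dim A =
     (SUP \<beta> \<in> {\<beta>::real. \<beta> \<le> 1 \<and>
        (\<exists>M C. real_distribution M \<and> emeasure M A = 1 \<and> C > 0 \<and>
           (\<forall>\<xi>. cmod (fourier_transform M \<xi>) \<le> C * (1 + \<bar>\<xi>\<bar>) powr (- \<beta> / 2)))}. ereal \<beta>)"

definition nontrivial_solution :: "real \<Rightarrow> real \<Rightarrow> real \<Rightarrow> real \<Rightarrow> bool" where
  "nontrivial_solution t x y z \<longleftrightarrow>
     t * x + (1 - t) * y = z \<and> x \<noteq> y \<and> y \<noteq> z \<and> x \<noteq> z"

end

theory Submission
  imports Defs
begin

text \<open>Let \<open>E\<close> be a Cantor set whose level-\<open>k\<close> intervals, of length \<open>1 / Q k\<close>, each contain the \<open>M k\<close> intervals of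
  the next level along a lattice of step \<open>R k / Q (k + 1)\<close>, where \<open>R k\<close> is of order \<open>(M k)\<^sup>\<tau> / c\<close> and only the
  offset of the lattice depends on the parent interval. If \<open>t x + (1 - t) y = z\<close>, then at the first
  level separating the three points \<open>t\<close> lies within \<open>1 / (R k m)\<close> of a fraction with denominator
  \<open>m < M k\<close>, so \<open>t\<close> is not badly approximable. Since the number of intervals is \<open>(Q k)\<close> to the power
  \<open>1 / (1 + \<tau>) + o(1)\<close>, an energy estimate with a Gaussian kernel bounds the Fourier dimension from above.
  For the lower bound, averaging over the \<open>R k\<close> offsets turns the next-level measure back into the
  uniform measure on the parent, and so offsets can be chosen such that consecutive levels differ in
  Fourier transform by the square-root cancellation over the parents, up to a logarithm, uniformly
  in the frequency; the differences sum up because \<open>M k\<close> is negligible against the number of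
  parents.\<close>

subsection \<open>Choice of the offsets\<close>

text \<open>For negative \<open>x = - y\<close> the product of \<open>1 - y + y\<^sup>2\<close> with
  the lower Taylor polynomial of \<open>exp y\<close> is at least 1; multiplying by
  \<open>exp (- y)\<close> then gives the bound.\<close>

lemma exp_le_quadratic:
  fixes x :: real
  assumes "\<bar>x\<bar> \<le> 1"
  shows "exp x \<le> 1 + x + x\<^sup>2"
proof (cases "0 \<le> x")
  case True
  then show ?thesis using assms exp_bound by auto
next
  case False
  define y where "y = - x"
  have y: "0 \<le> y" "y \<le> 1" using False assms by (auto simp: y_def)
  have lower: "1 + y + y\<^sup>2 / 2 \<le> exp y"
    using exp_lower_Taylor_quadratic[OF y(1)] .
  have "(1 - y + y\<^sup>2) * (1 + y + y\<^sup>2 / 2) = 1 + y\<^sup>2 / 2 + y^3 / 2 + y^4 / 2"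
    by (simp add: field_simps power2_eq_square power3_eq_cube power4_eq_xxxx)
  then have "1 \<le> (1 - y + y\<^sup>2) * (1 + y + y\<^sup>2 / 2)"
    using y by simp
  also have "\<dots> \<le> (1 - y + y\<^sup>2) * exp y"
    using lower y by (intro mult_left_mono) (auto simp: add_nonneg_nonneg)
  finally have "exp (- y) \<le> 1 - y + y\<^sup>2"
    by (simp add: exp_minus field_simps)
  then show ?thesis by (simp add: y_def)
qed

text \<open>A deterministic form of Hoeffding's inequality with a union bound: choose the \<open>j n\<close> one after the other
  so that \<open>\<Sum>g\<in>\<Gamma>. exp (\<mu> * (\<Sum>i<n. X i (j i) g))\<close> grows at most as it does on average.\<close>

lemma exists_small_sums:
  fixes X :: "nat \<Rightarrow> nat \<Rightarrow> 'g \<Rightarrow> real"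
  assumes fin: "finite \<Gamma>" and ne: "\<Gamma> \<noteq> {}" and N: "N \<ge> 1" and R: "R \<ge> 1"
    and bounded: "\<And>n r g. \<bar>X n r g\<bar> \<le> 1"
    and centred: "\<And>n g. (\<Sum>r<R. X n r g) = 0"
  shows "\<exists>j. (\<forall>n. j n < R) \<and>
             (\<forall>g\<in>\<Gamma>. (\<Sum>n<N. X n (j n) g) \<le> sqrt N * (1 + ln (card \<Gamma>)))"
proof -
  \<comment> \<open>This choice keeps \<open>(1 + \<mu>\<^sup>2) ^ N\<close> below
    \<open>exp 1\<close>, while passing from \<open>\<mu>\<close> times the sum to the sum itself
    costs only the factor \<open>sqrt N\<close>.\<close>
  define \<mu> where "\<mu> = 1 / sqrt N"
  have \<mu>: "0 < \<mu>" "\<mu> \<le> 1" and \<mu>2: "\<mu>\<^sup>2 = 1 / N"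
    using N by (auto simp: \<mu>_def power_divide)
  have potential: "\<exists>j. (\<forall>n. j n < R) \<and>
      (\<Sum>g\<in>\<Gamma>. exp (\<mu> * (\<Sum>i<n. X i (j i) g))) \<le> card \<Gamma> * (1 + \<mu>\<^sup>2) ^ n" for n
  proof (induction n)
    case 0
    then show ?case using R by (intro exI[of _ "\<lambda>_. 0"]) auto
  next
    case (Suc n)
    then obtain j where j: "\<forall>n. j n < R"
      and j_le: "(\<Sum>g\<in>\<Gamma>. exp (\<mu> * (\<Sum>i<n. X i (j i) g))) \<le> card \<Gamma> * (1 + \<mu>\<^sup>2) ^ n"
      by blast
    define w where "w g = exp (\<mu> * (\<Sum>i<n. X i (j i) g))" for g
    \<comment> \<open>Summing over \<open>r\<close> removes the linear term by
      \<open>centred\<close>; what is left is the factor \<open>1 + \<mu>\<^sup>2\<close> on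
      average.\<close>
    have "(\<Sum>r<R. \<Sum>g\<in>\<Gamma>. w g * exp (\<mu> * X n r g))
        \<le> (\<Sum>r<R. \<Sum>g\<in>\<Gamma>. w g * (1 + \<mu> * X n r g + \<mu>\<^sup>2))"
    proof (intro sum_mono mult_left_mono)
      fix r g
      have "\<bar>\<mu> * X n r g\<bar> \<le> 1"
        using \<mu> bounded[of n r g] by (simp add: abs_mult mult_le_one)
      then have "exp (\<mu> * X n r g) \<le> 1 + \<mu> * X n r g + (\<mu> * X n r g)\<^sup>2"
        by (rule exp_le_quadratic)
      also have "(\<mu> * X n r g)\<^sup>2 \<le> \<mu>\<^sup>2"
        using bounded[of n r g] \<mu> by (simp add: power_mult_distrib mult_left_le abs_square_le_1)
      finally show "exp (\<mu> * X n r g) \<le> 1 + \<mu> * X n r g + \<mu>\<^sup>2" by simp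
    qed (simp add: w_def)
    also have "\<dots> = (\<Sum>g\<in>\<Gamma>. \<Sum>r<R. w g * (1 + \<mu>\<^sup>2) + w g * \<mu> * X n r g)"
      by (subst sum.swap) (simp add: algebra_simps)
    also have "\<dots> = (\<Sum>g\<in>\<Gamma>. R * (w g * (1 + \<mu>\<^sup>2)))"
      by (intro sum.cong refl) (simp add: sum.distrib centred flip: sum_distrib_left)
    also have "\<dots> = R * ((1 + \<mu>\<^sup>2) * sum w \<Gamma>)"
      by (simp add: sum_distrib_left sum_distrib_right mult.commute)
    finally have avg: "(\<Sum>r<R. \<Sum>g\<in>\<Gamma>. w g * exp (\<mu> * X n r g)) \<le> R * ((1 + \<mu>\<^sup>2) * sum w \<Gamma>)" .
    have "\<exists>r<R. (\<Sum>g\<in>\<Gamma>. w g * exp (\<mu> * X n r g)) \<le> (1 + \<mu>\<^sup>2) * sum w \<Gamma>"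
    proof (rule ccontr)
      assume "\<not> ?thesis"
      then have "\<And>r. r \<in> {..<R} \<Longrightarrow> (1 + \<mu>\<^sup>2) * sum w \<Gamma> < (\<Sum>g\<in>\<Gamma>. w g * exp (\<mu> * X n r g))"
        by (auto simp: not_le)
      then have "(\<Sum>r<R. (1 + \<mu>\<^sup>2) * sum w \<Gamma>) < (\<Sum>r<R. \<Sum>g\<in>\<Gamma>. w g * exp (\<mu> * X n r g))"
        using R by (intro sum_strict_mono) (auto simp: lessThan_empty_iff)
      then show False using avg by simp
    qed
    then obtain r where r: "r < R"
      and r_le: "(\<Sum>g\<in>\<Gamma>. w g * exp (\<mu> * X n r g)) \<le> (1 + \<mu>\<^sup>2) * sum w \<Gamma>" by blast
    have "(\<Sum>i<Suc n. X i ((j(n := r)) i) g) = (\<Sum>i<n. X i (j i) g) + X n r g" for g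
    proof -
      have "(\<Sum>i<n. X i ((j(n := r)) i) g) = (\<Sum>i<n. X i (j i) g)"
        by (intro sum.cong) auto
      then show ?thesis by simp
    qed
    then have "(\<Sum>g\<in>\<Gamma>. exp (\<mu> * (\<Sum>i<Suc n. X i ((j(n := r)) i) g)))
        = (\<Sum>g\<in>\<Gamma>. w g * exp (\<mu> * X n r g))"
      by (simp add: w_def distrib_left exp_add)
    also have "\<dots> \<le> (1 + \<mu>\<^sup>2) * (card \<Gamma> * (1 + \<mu>\<^sup>2) ^ n)"
      using r_le j_le by (smt (verit) mult_left_mono sum_mono w_def sum.cong zero_le_power2)
    finally show ?case
      using j r by (intro exI[of _ "j(n := r)"]) (simp add: algebra_simps)
  qed
  obtain j where j: "\<forall>n. j n < R"
    and j_le: "(\<Sum>g\<in>\<Gamma>. exp (\<mu> * (\<Sum>i<N. X i (j i) g))) \<le> card \<Gamma> * (1 + \<mu>\<^sup>2) ^ N"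
    using potential[of N] by blast
  have card: "real (card \<Gamma>) > 0" using fin ne by (simp add: card_gt_0_iff)
  have "(1 + \<mu>\<^sup>2) ^ N \<le> exp (\<mu>\<^sup>2) ^ N"
    by (intro power_mono) auto
  also have "\<dots> = exp 1"
    using N by (simp add: \<mu>2 flip: exp_of_nat_mult)
  finally have pow: "(1 + \<mu>\<^sup>2) ^ N \<le> exp 1" .
  have "(\<Sum>n<N. X n (j n) g) \<le> sqrt N * (1 + ln (card \<Gamma>))" if "g \<in> \<Gamma>" for g
  proof -
    have "exp (\<mu> * (\<Sum>i<N. X i (j i) g)) \<le> (\<Sum>g\<in>\<Gamma>. exp (\<mu> * (\<Sum>i<N. X i (j i) g)))"
      using that fin by (intro member_le_sum) auto
    also have "\<dots> \<le> card \<Gamma> * exp 1"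
      using j_le pow card by (smt (verit) mult_left_mono)
    also have "\<dots> = exp (1 + ln (card \<Gamma>))"
      using card by (simp add: exp_add)
    finally have "\<mu> * (\<Sum>i<N. X i (j i) g) \<le> 1 + ln (card \<Gamma>)" by simp
    then show ?thesis using N by (simp add: \<mu>_def field_simps)
  qed
  with j show ?thesis by blast
qed

lemma norm_cis_diff_le: "norm (cis a - cis b) \<le> \<bar>a - b\<bar>"
proof -
  have "cis a - cis b = cis b * (cis (a - b) - 1)"
    by (simp add: algebra_simps cis_mult)
  then have "norm (cis a - cis b) = norm (cis (a - b) - 1)"
    by (simp add: norm_mult)
  also have "\<dots> \<le> \<bar>a - b\<bar>"
    using iexp_approx1[of "a - b" 0] by (simp add: cis_conv_exp)
  finally show ?thesis .
qed

text \<open>All frequencies \<open>d\<close> are integers, so exponential sums are periodic and a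
  finite grid on one period can control them.\<close>

lemma cis_minus_frac:
  fixes d :: nat
  shows "cis (- (2 * pi * frac x) * d) = cis (- (2 * pi * x) * d)"
proof -
  have "- (2 * pi * frac x) * d = - (2 * pi * x) * d + 2 * pi * of_int (\<lfloor>x\<rfloor> * int d)"
    by (simp add: frac_def algebra_simps)
  then show ?thesis
    by (metis Ints_of_int cis_mult cis_multiple_2pi mult.right_neutral)
qed

lemma cmod_le_of_parts:
  assumes "Re z \<le> b" "- Re z \<le> b" "Im z \<le> b" "- Im z \<le> b"
  shows "cmod z \<le> 2 * b"
  using cmod_le[of z] assms by linarith

lemma sum_product_index:
  fixes f :: "nat \<Rightarrow> 'a::comm_monoid_add"
  shows "(\<Sum>m<N * M. f m) = (\<Sum>n<N. \<Sum>a<M. f (n * M + a))"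
proof -
  have "(\<Sum>n<N. \<Sum>a<M. f (n * M + a)) = (\<Sum>n<N. sum f {n * M..<n * M + M})"
    by (simp add: sum.atLeastLessThan_shift_0[of f "_ * M"] atLeast0LessThan)
  then show ?thesis by (simp add: sum.nat_group)
qed

lemma norm_average_le:
  fixes f :: "nat \<Rightarrow> complex"
  assumes "\<And>i. i < n \<Longrightarrow> norm (f i) \<le> b" and "n \<ge> 1"
  shows "norm ((\<Sum>i<n. f i) / n) \<le> b"
proof -
  have "norm (\<Sum>i<n. f i) \<le> (\<Sum>i<n. norm (f i))" by (rule norm_sum)
  also have "\<dots> \<le> n * b" using sum_bounded_above[of "{..<n}" "\<lambda>i. norm (f i)" b] assms(1) by simp
  finally show ?thesis using \<open>n \<ge> 1\<close> by (simp add: norm_divide field_simps)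
qed

text \<open>The contribution of parent \<open>n\<close>: its \<open>M\<close> children with offset
  \<open>r\<close> against all \<open>M * R\<close> cells of the parent. Positions are counted in
  cells of the next level, so they are integers.\<close>

definition offset_error :: "(nat \<Rightarrow> nat) \<Rightarrow> nat \<Rightarrow> nat \<Rightarrow> nat \<Rightarrow> nat \<Rightarrow> real \<Rightarrow> complex" where
  "offset_error A M R n r \<theta> =
     (\<Sum>a<M. cis (- \<theta> * real (M * R * A n + a * R + r))) / M
     - (\<Sum>d<M * R. cis (- \<theta> * real (M * R * A n + d))) / (M * R)"

text \<open>The sum is a trigonometric polynomial of degree below \<open>Q * (M * R)\<close>, so it suffices to control it on a
  grid of \<open>(Q * (M * R))\<^sup>2\<close> points.\<close>

lemma exists_offsets:
  assumes N: "N \<ge> 1" and M: "M \<ge> 1" and R: "R \<ge> 1" and NQ: "N \<le> Q"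
    and A: "\<And>n. n < N \<Longrightarrow> A n < Q"
  shows "\<exists>j. (\<forall>n. j n < R) \<and>
    (\<forall>\<theta>. cmod (\<Sum>n<N. offset_error A M R n (j n) \<theta>) \<le> 40 * sqrt N * (1 + ln (real (Q * (M * R)))))"
proof -
  define L where "L = M * R"
  define Q' where "Q' = Q * L"
  \<comment> \<open>The sum of \<open>N \<le> Q'\<close> terms, each with Lipschitz constant
    \<open>2 * Q'\<close>, varies by at most \<open>4 * pi\<close> over one step
    \<open>2 * pi / G\<close> of a grid this fine.\<close>
  define G where "G = Q'\<^sup>2"
  have L1: "L \<ge> 1" using M R by (simp add: L_def)
  have NQ': "N \<le> Q'" using mult_le_mono[OF NQ L1] by (simp add: Q'_def)
  have Q'1: "Q' \<ge> 1" and G1: "G \<ge> 1" using N NQ' by (auto simp: G_def)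
  define Y where "Y = offset_error A M R"
  \<comment> \<open>The second component \<open>s < 4\<close> rotates by \<open>\<i> ^ s\<close>:
    the real parts of the four rotations are the real and imaginary parts up to both signs, so
    one-sided bounds control the modulus. Halving normalises, since \<open>Y\<close> is bounded by
    2.\<close>
  define X :: "nat \<Rightarrow> nat \<Rightarrow> nat \<times> nat \<Rightarrow> real"
    where "X n r p = Re (\<i> ^ snd p * Y n r (2 * pi * (real (fst p) / real G))) / 2" for n r p
  have Y_bound: "cmod (Y n r \<theta>) \<le> 2" for n r \<theta>
  proof -
    have "cmod (Y n r \<theta>) \<le> 1 + 1"
      unfolding Y_def offset_error_def of_nat_mult[symmetric]
      by (rule order.trans[OF norm_triangle_ineq4], rule add_mono; rule norm_average_le)
         (use M R in auto)
    then show ?thesis by simp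
  qed
  have X_bound: "\<bar>X n r p\<bar> \<le> 1" for n r p
  proof -
    have "\<bar>Re (\<i> ^ snd p * Y n r (2 * pi * (real (fst p) / real G)))\<bar> \<le> cmod (\<i> ^ snd p * Y n r (2 * pi * (real (fst p) / real G)))"
      by (rule abs_Re_le_cmod)
    also have "\<dots> \<le> 2" by (simp only: norm_mult norm_power norm_ii power_one mult_1 Y_bound)
    finally show ?thesis by (simp add: X_def)
  qed
  have Y_sum: "(\<Sum>r<R. Y n r \<theta>) = 0" for n \<theta>
  proof -
    \<comment> \<open>Writing \<open>d = a * R + r\<close>, the \<open>R\<close> shifted lattices
      partition the cells of the parent; hence the errors cancel when summed over
      \<open>r\<close>.\<close>
    have "(\<Sum>d<M * R. cis (- \<theta> * real (M * R * A n + d)))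
        = (\<Sum>r<R. \<Sum>a<M. cis (- \<theta> * real (M * R * A n + a * R + r)))"
      by (subst sum_product_index, subst sum.swap) (simp add: add.assoc)
    then show ?thesis
      using R by (simp add: Y_def offset_error_def sum_subtractf flip: sum_divide_distrib)
  qed
  have X_sum: "(\<Sum>r<R. X n r p) = 0" for n p
  proof -
    have "(\<Sum>r<R. X n r p) = Re (\<i> ^ snd p * (\<Sum>r<R. Y n r (2 * pi * (real (fst p) / real G)))) / 2"
      unfolding X_def by (simp add: sum_distrib_left flip: sum_divide_distrib)
    then show ?thesis by (simp add: Y_sum)
  qed
  obtain j where j: "\<And>n. j n < R"
    and j_le: "\<And>p. p \<in> {..<G} \<times> {..<4} \<Longrightarrow>
       (\<Sum>n<N. X n (j n) p) \<le> sqrt N * (1 + ln (card ({..<G} \<times> {..<4::nat})))"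
    using exists_small_sums[of "{..<G} \<times> {..<4::nat}" N R X, OF _ _ N R X_bound X_sum] G1
    by fastforce
  define P where "P \<theta> = (\<Sum>n<N. Y n (j n) \<theta>)" for \<theta>
  define b where "b = 2 * (sqrt N * (1 + ln (4 * real G)))"
  have grid: "cmod (P (2 * pi * (g / G))) \<le> 2 * b" if "g < G" for g :: nat
  proof -
    have "Re (\<i> ^ s * P (2 * pi * (g / G))) \<le> b" if "s < 4" for s
    proof -
      have "Re (\<i> ^ s * P (2 * pi * (g / G))) / 2 = (\<Sum>n<N. X n (j n) (g, s))"
        by (simp add: P_def X_def sum_distrib_left flip: sum_divide_distrib)
      also have "\<dots> \<le> b / 2"
        using j_le[of "(g, s)"] \<open>g < G\<close> \<open>s < 4\<close> by (simp add: b_def card_cartesian_product mult.commute)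
      finally show ?thesis by simp
    qed
    from this[of 0] this[of 1] this[of 2] this[of 3] show ?thesis
      by (intro cmod_le_of_parts) (simp_all add: eval_nat_numeral)
  qed
  have Y_lipschitz: "cmod (Y n r \<theta> - Y n r \<theta>') \<le> 2 * (Q' * \<bar>\<theta> - \<theta>'\<bar>)" if "n < N" "r < R" for n r and \<theta> \<theta>' :: real
  proof -
    have cis_le: "cmod (cis (- \<theta> * real d) - cis (- \<theta>' * real d)) \<le> Q' * \<bar>\<theta> - \<theta>'\<bar>" if "d \<le> Q'" for d
    proof -
      have "cmod (cis (- \<theta> * real d) - cis (- \<theta>' * real d)) \<le> \<bar>- \<theta> * real d - - \<theta>' * real d\<bar>"
        by (rule norm_cis_diff_le)
      also have "- \<theta> * real d - - \<theta>' * real d = real d * (\<theta>' - \<theta>)" by (simp add: algebra_simps)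
      also have "\<bar>\<dots>\<bar> = real d * \<bar>\<theta> - \<theta>'\<bar>" by (simp add: abs_mult abs_minus_commute)
      also have "\<dots> \<le> Q' * \<bar>\<theta> - \<theta>'\<bar>" using that by (intro mult_right_mono) auto
      finally show ?thesis .
    qed
    have "L * (A n + 1) \<le> L * Q" using A[OF \<open>n < N\<close>] by (intro mult_le_mono) auto
    then have top: "L * A n + L \<le> Q'" by (simp add: Q'_def mult.commute)
    have 1: "L * A n + a * R + r \<le> Q'" if "a < M" for a
    proof -
      have "(a + 1) * R \<le> M * R" using that by (intro mult_le_mono) auto
      then have "a * R + R \<le> L" by (simp add: L_def)
      then show ?thesis using top \<open>r < R\<close> by linarith
    qed
    have "Y n r \<theta> - Y n r \<theta>' =
       (\<Sum>a<M. cis (- \<theta> * real (L * A n + a * R + r)) - cis (- \<theta>' * real (L * A n + a * R + r))) / M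
       - (\<Sum>d<L. cis (- \<theta> * real (L * A n + d)) - cis (- \<theta>' * real (L * A n + d))) / L"
      by (simp add: Y_def offset_error_def sum_subtractf diff_divide_distrib L_def)
    also have "cmod \<dots> \<le> Q' * \<bar>\<theta> - \<theta>'\<bar> + Q' * \<bar>\<theta> - \<theta>'\<bar>"
      by (rule order.trans[OF norm_triangle_ineq4], rule add_mono; rule norm_average_le; (rule cis_le)?)
         (use M L1 1 top in auto)
    finally show ?thesis by simp
  qed
  have "cmod (P \<theta>) \<le> 40 * sqrt N * (1 + ln (real Q'))" for \<theta>
  proof -
    define x where "x = \<theta> / (2 * pi)"
    have \<theta>: "\<theta> = 2 * pi * x" by (simp add: x_def)
    have lnQ: "0 \<le> ln (real Q')" using Q'1 by simp
    have P_frac: "P \<theta> = P (2 * pi * frac x)"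
      unfolding \<theta> P_def Y_def offset_error_def by (simp only: cis_minus_frac)
    \<comment> \<open>The grid point just to the left of \<open>frac x\<close>.\<close>
    define g where "g = nat \<lfloor>frac x * G\<rfloor>"
    have g_floor: "real g = of_int \<lfloor>frac x * G\<rfloor>" by (simp add: g_def)
    have "frac x * G < G" using frac_lt_1[of x] G1 by simp
    then have "real g < real G" unfolding g_floor by linarith
    then have g: "g < G" by simp
    have "\<bar>frac x * G - g\<bar> \<le> 1" unfolding g_floor by linarith
    moreover have "\<bar>frac x * G - g\<bar> = \<bar>frac x - g / G\<bar> * G"
      using G1 by (simp add: abs_mult_pos' left_diff_distrib abs_mult_pos)
    ultimately have near: "\<bar>frac x - g / G\<bar> \<le> 1 / G"
      using G1 by (simp add: pos_le_divide_eq)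
    have "cmod (P (2 * pi * frac x) - P (2 * pi * (g / G)))
        \<le> (\<Sum>n<N. cmod (Y n (j n) (2 * pi * frac x) - Y n (j n) (2 * pi * (g / G))))"
      unfolding P_def sum_subtractf[symmetric] by (rule norm_sum)
    also have "\<dots> \<le> (\<Sum>n<N. 2 * (Q' * \<bar>2 * pi * frac x - 2 * pi * (g / G)\<bar>))"
      using j by (intro sum_mono Y_lipschitz) auto
    also have "\<dots> = N * (2 * (Q' * (2 * pi * \<bar>frac x - g / G\<bar>)))"
      by (simp only: right_diff_distrib[symmetric] abs_mult) simp
    also have "\<dots> \<le> Q' * (2 * (Q' * (2 * pi * (1 / G))))"
      using near NQ' by (intro mult_mono) auto
    also have "\<dots> = 4 * pi" using Q'1 by (simp add: G_def power2_eq_square)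
    also have "\<dots> \<le> 16 * sqrt N" using pi_less_4 N by (smt (verit) of_nat_1 of_nat_le_iff real_sqrt_ge_1_iff)
    finally have "cmod (P \<theta>) \<le> 2 * b + 16 * sqrt N"
      using grid[OF g] P_frac norm_triangle_sub[of "P \<theta>" "P (2 * pi * (g / G))"] by simp
    also have "b = 2 * sqrt N * (1 + ln 4 + 2 * ln (real Q'))"
      using Q'1 by (simp add: b_def G_def ln_mult ln_realpow)
    also have "2 * (2 * sqrt N * (1 + ln 4 + 2 * ln (real Q'))) + 16 * sqrt N
        = sqrt N * (20 + 4 * ln 4 + 8 * ln (real Q'))"
      by (simp add: algebra_simps)
    \<comment> \<open>\<open>ln 4 \<le> 3\<close> turns \<open>20 + 4 * ln 4\<close> into at most
      32, which leaves room in the constant 40.\<close>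
    also have "\<dots> \<le> sqrt N * (40 + 40 * ln (real Q'))"
      using ln_le_minus_one[of "4::real"] lnQ by (intro mult_left_mono) auto
    finally show ?thesis by (simp add: algebra_simps)
  qed
  then show ?thesis using j unfolding P_def Y_def Q'_def L_def by blast
qed

text \<open>The product of the parent sum with the sum over \<open>d\<close> is the exponential sum
  over all cells of all parents, so the difference is the mean of the offset errors. Dividing by
  \<open>N\<close> turns \<open>sqrt N\<close> into \<open>1 / sqrt N\<close>.\<close>

lemma exists_refinement:
  assumes N: "N \<ge> 1" and M: "M \<ge> 1" and R: "R \<ge> 1" and NQ: "N \<le> Q"
    and A: "\<And>n. n < N \<Longrightarrow> A n < Q"
  shows "\<exists>j. (\<forall>n. j n < R) \<and>
    (\<forall>\<theta>. cmod ((\<Sum>m<N * M. cis (- \<theta> * real (M * R * A (m div M) + (m mod M) * R + j (m div M)))) / (N * M)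
              - (\<Sum>n<N. cis (- \<theta> * real (M * R * A n))) / N * ((\<Sum>d<M * R. cis (- \<theta> * real d)) / (M * R)))
       \<le> 40 * (1 + ln (real (Q * (M * R)))) / sqrt N)"
proof -
  obtain j where j: "\<forall>n. j n < R"
    and j_le: "\<And>\<theta>. cmod (\<Sum>n<N. offset_error A M R n (j n) \<theta>) \<le> 40 * sqrt N * (1 + ln (real (Q * (M * R))))"
    using exists_offsets[OF N M R NQ, of A] A by blast
  have "cmod ((\<Sum>m<N * M. cis (- \<theta> * real (M * R * A (m div M) + (m mod M) * R + j (m div M)))) / (N * M)
              - (\<Sum>n<N. cis (- \<theta> * real (M * R * A n))) / N * ((\<Sum>d<M * R. cis (- \<theta> * real d)) / (M * R)))
       \<le> 40 * (1 + ln (real (Q * (M * R)))) / sqrt N" (is "cmod (?S - ?T) \<le> _") for \<theta>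
  proof -
    have "?S = (\<Sum>n<N. (\<Sum>a<M. cis (- \<theta> * real (M * R * A n + a * R + j n))) / M) / N"
      using M by (subst sum_product_index) (simp flip: sum_divide_distrib)
    moreover have "?T = (\<Sum>n<N. (\<Sum>d<M * R. cis (- \<theta> * real (M * R * A n + d))) / (M * R)) / N"
      by (simp add: sum_product sum_divide_distrib cis_mult distrib_left flip: sum_divide_distrib)
    ultimately have "?S - ?T = (\<Sum>n<N. offset_error A M R n (j n) \<theta>) / N"
      by (simp add: offset_error_def sum_subtractf diff_divide_distrib)
    then have "cmod (?S - ?T) \<le> 40 * sqrt N * (1 + ln (real (Q * (M * R)))) / N"
      using j_le[of \<theta>] N by (simp add: norm_divide divide_right_mono)
    also have "\<dots> = 40 * (1 + ln (real (Q * (M * R)))) / sqrt N"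
      by (simp only: times_divide_eq_left[symmetric] mult.commute[of 40] mult.assoc
          sqrt_divide_self_eq[OF of_nat_0_le_iff] flip: times_divide_eq_right)
         (simp add: divide_inverse)
    finally show ?thesis .
  qed
  with j show ?thesis by blast
qed

subsection \<open>Cantor sets with lattice children\<close>

text \<open>The level-\<open>k\<close> intervals start at \<open>A k n / Q k\<close>, so the
  geometry is integer arithmetic. Child \<open>m\<close> has parent \<open>m div M k\<close> and
  lattice position \<open>m mod M k\<close>; the recursion holds for all \<open>m\<close>, although
  only indices below \<open>N k\<close> name intervals of the construction.\<close>

locale cantor_scheme =
  fixes M R :: "nat \<Rightarrow> nat" and j A :: "nat \<Rightarrow> nat \<Rightarrow> nat"
  assumes M_ge_1: "M k \<ge> 1" and R_ge_2: "R k \<ge> 2"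
    and j_less: "j k n < R k"
    and A_0: "A 0 n = 0"
    and A_Suc: "A (Suc k) m = M k * R k * A k (m div M k) + (m mod M k) * R k + j k (m div M k)"
begin

definition N :: "nat \<Rightarrow> nat" where "N k = (\<Prod>i<k. M i)"

definition Q :: "nat \<Rightarrow> nat" where "Q k = (\<Prod>i<k. M i * R i)"

definition interval :: "nat \<Rightarrow> nat \<Rightarrow> real set" where
  "interval k n = {x. real (A k n) \<le> Q k * x \<and> Q k * x \<le> real (A k n) + 1}"

definition E :: "real set" where "E = {x. \<forall>k. \<exists>n<N k. x \<in> interval k n}"

lemma N_0 [simp]: "N 0 = 1" and N_Suc: "N (Suc k) = N k * M k"
  and Q_0 [simp]: "Q 0 = 1" and Q_Suc: "Q (Suc k) = Q k * (M k * R k)"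
  by (simp_all add: N_def Q_def)

lemma N_ge_1: "N k \<ge> 1"
  unfolding N_def by (intro prod_ge_1 M_ge_1)

lemma N_le_Q: "N k \<le> Q k"
  unfolding N_def Q_def
proof (intro prod_mono conjI)
  show "M i \<le> M i * R i" for i using R_ge_2[of i] by simp
qed simp

lemma Q_ge: "2 ^ k \<le> Q k"
proof -
  have "(\<Prod>i<k. 2) \<le> (\<Prod>i<k. M i * R i)"
  proof (intro prod_mono conjI)
    show "2 \<le> M i * R i" for i using mult_le_mono[OF M_ge_1[of i] R_ge_2[of i]] by simp
  qed simp
  then show ?thesis by (simp add: Q_def)
qed

lemma Q_pos [simp]: "Q k > 0"
  using Q_ge[of k] by (meson less_le_trans zero_less_numeral zero_less_power)

text \<open>These two bounds are the nesting of the intervals in integer form: the last possible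
  child starts at cell \<open>(M k - 1) * R k + R k - 1\<close>, which is exactly the last cell of
  the parent.\<close>

lemma
  shows A_Suc_lower: "M k * R k * A k (m div M k) \<le> A (Suc k) m"
    and A_Suc_upper: "A (Suc k) m + 1 \<le> M k * R k * (A k (m div M k) + 1)"
proof -
  have "m mod M k < M k" using M_ge_1[of k] by simp
  then have "(m mod M k + 1) * R k \<le> M k * R k" by (intro mult_le_mono) auto
  then show "A (Suc k) m + 1 \<le> M k * R k * (A k (m div M k) + 1)"
    using j_less[of k "m div M k"] by (simp add: A_Suc)
qed (simp add: A_Suc)

lemma div_less_N: "m < N (Suc k) \<Longrightarrow> m div M k < N k"
  by (simp add: N_Suc less_mult_imp_div_less)

text \<open>The gap is 2 because closed unit cells at distance 1 would share an endpoint. Siblings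
  are at least \<open>R k \<ge> 2\<close> apart; for different parents the parental gap leaves a
  whole free block of \<open>M k * R k\<close> cells.\<close>

lemma A_gap: "m < n \<Longrightarrow> n < N k \<Longrightarrow> A k m + 2 \<le> A k n"
proof (induction k arbitrary: m n)
  case 0
  then show ?case by simp
next
  case (Suc k)
  have L: "2 \<le> M k * R k" using mult_le_mono[OF M_ge_1[of k] R_ge_2[of k]] by simp
  show ?case
  proof (cases "m div M k = n div M k")
    case True
    then have "m mod M k < n mod M k"
      using \<open>m < n\<close> by (metis div_mult_mod_eq nat_add_left_cancel_less)
    then have "(m mod M k + 1) * R k \<le> (n mod M k) * R k" by (intro mult_le_mono) auto
    then show ?thesis using True R_ge_2[of k] by (simp add: A_Suc)
  next
    case False
    then have "m div M k < n div M k"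
      using \<open>m < n\<close> by (simp add: div_le_mono order_less_le)
    then have "A k (m div M k) + 1 + 1 \<le> A k (n div M k)"
      using Suc.IH div_less_N[OF Suc.prems(2)] by fastforce
    then have "M k * R k * (A k (m div M k) + 1 + 1) \<le> M k * R k * A k (n div M k)"
      by (rule mult_le_mono2)
    then have "M k * R k * (A k (m div M k) + 1) + M k * R k \<le> A (Suc k) n"
      using A_Suc_lower[of k n] by (simp only: distrib_left mult_1_right)
    then show ?thesis using A_Suc_upper[of k m] L by linarith
  qed
qed

lemma interval_unique:
  assumes "x \<in> interval k m" "x \<in> interval k n" "m < N k" "n < N k"
  shows "m = n"
  using assms A_gap[of m n k] A_gap[of n m k] unfolding interval_def
  by (cases m n rule: linorder_cases) auto

lemma interval_Suc_subset: "interval (Suc k) m \<subseteq> interval k (m div M k)"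
proof
  fix x assume x: "x \<in> interval (Suc k) m"
  have L: "0 < real (M k * R k)" using M_ge_1[of k] R_ge_2[of k] by simp
  have "real (M k * R k) * real (A k (m div M k)) \<le> A (Suc k) m"
    using of_nat_mono[OF A_Suc_lower[of k m], where 'a = real] by simp
  also have "\<dots> \<le> real (M k * R k) * (Q k * x)"
    using x by (simp add: interval_def Q_Suc mult_ac)
  finally have 1: "real (A k (m div M k)) \<le> Q k * x"
    using L by (rule mult_left_le_imp_le)
  have "real (M k * R k) * (Q k * x) \<le> A (Suc k) m + 1"
    using x by (simp add: interval_def Q_Suc mult_ac)
  also have "\<dots> \<le> real (M k * R k) * (real (A k (m div M k)) + 1)"
    using of_nat_mono[OF A_Suc_upper[of k m], where 'a = real] by (simp add: algebra_simps)
  finally have 2: "Q k * x \<le> real (A k (m div M k)) + 1"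
    using L by (rule mult_left_le_imp_le)
  show "x \<in> interval k (m div M k)"
    using 1 2 by (simp add: interval_def)
qed

lemma interval_0: "interval 0 n = {0..1}"
  by (auto simp: interval_def A_0)

lemma closed_interval: "closed (interval k n)"
  unfolding interval_def by (intro closed_Collect_conj closed_Collect_le continuous_intros)

lemma E_subset: "E \<subseteq> {0..1}"
  by (auto simp: E_def interval_0 dest: spec[of _ 0])

lemma E_borel: "E \<in> sets borel"
proof -
  have "E = (\<Inter>k. \<Union>n<N k. interval k n)" by (auto simp: E_def)
  moreover have "closed (\<Inter>k. \<Union>n<N k. interval k n)"
    by (intro closed_INT ballI closed_UN closed_interval) auto
  ultimately show ?thesis by simp
qed

text \<open>At the first level separating \<open>x\<close>, \<open>y\<close>, \<open>z\<close> the three points lie near one and the same lattice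
  of step \<open>R k\<close> with \<open>M k\<close> points, so that \<open>t\<close> is close to a fraction with denominator below \<open>M k\<close>.\<close>

lemma rational_approximation:
  fixes t x y z :: real
  assumes "0 < t" "t < 1" and "x \<in> E" "y \<in> E" "z \<in> E"
    and eq: "t * x + (1 - t) * y = z" and "x \<noteq> y"
  obtains k and m q :: int where "m \<noteq> 0" "\<bar>m\<bar> < int (M k)" "R k * \<bar>t * of_int m - of_int q\<bar> \<le> 1"
proof -
  define P where "P k \<longleftrightarrow> (\<exists>n<N k. x \<in> interval k n \<and> y \<in> interval k n \<and> z \<in> interval k n)" for k
  have "P 0" using assms(3-5) E_subset by (auto simp: P_def interval_0)
  \<comment> \<open>The lengths \<open>1 / Q k\<close> are at most \<open>1 / 2 ^ k\<close>, so the
    distinct points \<open>x\<close> and \<open>y\<close> cannot share an interval at every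
    level.\<close>
  have "\<exists>k. \<not> P k"
  proof (rule ccontr)
    assume "\<nexists>k. \<not> P k"
    have small: "2 ^ k * \<bar>x - y\<bar> \<le> 1" for k
    proof -
      from \<open>\<nexists>k. \<not> P k\<close> obtain n where "x \<in> interval k n" "y \<in> interval k n"
        by (auto simp: P_def)
      then have "\<bar>Q k * x - Q k * y\<bar> \<le> 1" by (auto simp: interval_def)
      also have "\<bar>Q k * x - Q k * y\<bar> = Q k * \<bar>x - y\<bar>"
        by (simp add: abs_mult flip: right_diff_distrib)
      finally have "Q k * \<bar>x - y\<bar> \<le> 1" .
      moreover have "2 ^ k * \<bar>x - y\<bar> \<le> Q k * \<bar>x - y\<bar>"
        using Q_ge[of k] by (intro mult_right_mono) (metis of_nat_le_iff of_nat_numeral of_nat_power, simp)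
      ultimately show ?thesis by linarith
    qed
    obtain k where "1 / \<bar>x - y\<bar> < 2 ^ k"
      using real_arch_pow[of 2 "1 / \<bar>x - y\<bar>"] by auto
    then show False using small[of k] \<open>x \<noteq> y\<close> by (simp add: field_simps)
  qed
  with \<open>P 0\<close> obtain k where "P k" and notP: "\<not> P (Suc k)"
    by (metis nat_induct)
  then obtain n where n: "n < N k" "x \<in> interval k n" "y \<in> interval k n" "z \<in> interval k n"
    by (auto simp: P_def)
  \<comment> \<open>The common origin of the lattice of children: the offset \<open>j k n\<close>
    depends only on the parent \<open>n\<close>, so it cancels in the affine relation.\<close>
  define B where "B = M k * R k * A k n + j k n"
  have child: "\<exists>a<M k. n * M k + a < N (Suc k) \<and> w \<in> interval (Suc k) (n * M k + a) \<and>
      real B + real a * real (R k) \<le> Q (Suc k) * w \<and> Q (Suc k) * w \<le> real B + real a * real (R k) + 1"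
    if "w \<in> E" "w \<in> interval k n" for w :: real
  proof -
    obtain m where m: "m < N (Suc k)" "w \<in> interval (Suc k) m"
      using \<open>w \<in> E\<close> by (auto simp: E_def)
    have "m div M k = n"
      using interval_unique[OF _ \<open>w \<in> interval k n\<close>] interval_Suc_subset m div_less_N n(1) by blast
    then have "n * M k + m mod M k = m" by (metis div_mult_mod_eq)
    moreover have "A (Suc k) m = B + (m mod M k) * R k"
      using \<open>m div M k = n\<close> by (simp add: A_Suc B_def)
    moreover have "m mod M k < M k" using M_ge_1[of k] by simp
    ultimately show ?thesis using m
      by (intro exI[of _ "m mod M k"]) (auto simp: interval_def)
  qed
  define x' y' z' where "x' = Q (Suc k) * x - B" and "y' = Q (Suc k) * y - B" and "z' = Q (Suc k) * z - B"
  obtain a where a: "a < M k" "n * M k + a < N (Suc k)" "x \<in> interval (Suc k) (n * M k + a)"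
    "a * R k \<le> x'" "x' \<le> a * R k + 1"
    using child[OF \<open>x \<in> E\<close> n(2)] by (auto simp: x'_def)
  obtain b where b: "b < M k" "y \<in> interval (Suc k) (n * M k + b)"
    "b * R k \<le> y'" "y' \<le> b * R k + 1"
    using child[OF \<open>y \<in> E\<close> n(3)] by (auto simp: y'_def)
  obtain d where d: "d < M k" "z \<in> interval (Suc k) (n * M k + d)"
    "d * R k \<le> z'" "z' \<le> d * R k + 1"
    using child[OF \<open>z \<in> E\<close> n(4)] by (auto simp: z'_def)
  have z': "z' = t * x' + (1 - t) * y'"
    using eq by (simp add: x'_def y'_def z'_def algebra_simps flip: eq)
  \<comment> \<open>The excess of \<open>x'\<close> and of \<open>y'\<close> over the lattice lies
    in [0, 1], and so does that of their convex combination. As the excess of \<open>z'\<close> lies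
    there too, the two differ by at most 1.\<close>
  have lo: "t * (a * R k) + (1 - t) * (b * R k) \<le> z'"
    unfolding z' using a(4) b(3) \<open>0 < t\<close> \<open>t < 1\<close> by (intro add_mono mult_left_mono) auto
  have "z' \<le> t * (a * R k + 1) + (1 - t) * (b * R k + 1)"
    unfolding z' using a(5) b(4) \<open>0 < t\<close> \<open>t < 1\<close> by (intro add_mono mult_left_mono) auto
  then have hi: "z' \<le> t * (a * R k) + (1 - t) * (b * R k) + 1"
    by (simp add: algebra_simps)
  have near: "\<bar>t * (a * R k) + (1 - t) * (b * R k) - d * R k\<bar> \<le> 1"
    using lo hi d by linarith
  also have "t * (a * R k) + (1 - t) * (b * R k) - d * R k
      = R k * (t * of_int (int a - int b) - of_int (int d - int b))"
    by (simp add: algebra_simps)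
  finally have approx: "R k * \<bar>t * of_int (int a - int b) - of_int (int d - int b)\<bar> \<le> 1"
    by (simp add: abs_mult)
  \<comment> \<open>If \<open>a = b\<close>, the estimate reads
    \<open>\<bar>a - d\<bar> * R k \<le> 1\<close>, and \<open>R k \<ge> 2\<close> forces
    \<open>a = d\<close>; then the three points would not be separated at this level.\<close>
  have "a \<noteq> b"
  proof
    assume "a = b"
    have "\<bar>real (a * R k) - real (d * R k)\<bar> \<le> 1"
      using near \<open>a = b\<close> by (simp add: algebra_simps)
    then have "real_of_int (\<bar>int a - int d\<bar> * int (R k)) \<le> real_of_int 1"
      by (simp add: abs_mult flip: left_diff_distrib)
    then have le_1: "\<bar>int a - int d\<bar> * int (R k) \<le> 1"
      by (simp only: of_int_le_iff)
    have "a = d"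
    proof (rule ccontr)
      assume "a \<noteq> d"
      then have "1 * 2 \<le> \<bar>int a - int d\<bar> * int (R k)"
        using R_ge_2[of k] by (intro mult_mono) auto
      with le_1 show False by simp
    qed
    then have "P (Suc k)" using a b d \<open>a = b\<close> by (auto simp: P_def)
    then show False using notP by simp
  qed
  then have "int a - int b \<noteq> 0" "\<bar>int a - int b\<bar> < int (M k)"
    using a(1) b(1) by auto
  then show thesis
    using approx by (rule that)
qed

text \<open>Let \<open>p\<close> be the denominator of \<open>q / m\<close> in lowest terms. Since
  \<open>p \<le> \<bar>m\<bar>\<close>, the two estimates for the distance give
  \<open>c * R k < p powr \<tau>\<close>, which is at most
  \<open>M k powr \<tau> \<le> c * R k\<close>.\<close>

lemma badly_approx_contradiction:
  fixes t c \<tau> :: real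
  assumes t: "t \<in> badly_approx c \<tau>" and "0 < \<tau>" "0 < c" and M_le: "M k powr \<tau> \<le> c * R k"
    and m: "m \<noteq> 0" "\<bar>m\<bar> < int (M k)" and approx: "R k * \<bar>t * of_int m - of_int q\<bar> \<le> 1"
  shows False
proof -
  define g where "g = gcd m q"
  define p where "p = nat \<bar>m div g\<bar>"
  \<comment> \<open>Denominators in \<open>badly_approx\<close> are positive, so the sign of
    \<open>m\<close> moves to the numerator.\<close>
  define q' where "q' = sgn m * (q div g)"
  have g: "g > 0" "g dvd m" "g dvd q" using m by (auto simp: g_def)
  have "m div g \<noteq> 0" using m g by (simp add: dvd_div_eq_0_iff)
  then have p1: "p \<ge> 1" by (simp add: p_def)
  have p_abs: "int p = \<bar>m div g\<bar>" by (simp add: p_def)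
  have cop: "coprime (m div g) (q div g)"
    unfolding g_def using m by (intro div_gcd_coprime) auto
  then have "coprime (int p) q'"
    unfolding p_abs q'_def using m by (cases m "0::int" rule: linorder_cases) auto
  moreover have frac: "of_int q' / of_nat p = (of_int q / of_int m :: real)"
  proof -
    have "of_int q' / (of_nat p :: real) = of_int q' / of_int \<bar>m div g\<bar>"
      using p_abs by (metis of_int_of_nat_eq)
    also have "\<dots> = of_int (q div g) / of_int (m div g)"
      using m g \<open>m div g \<noteq> 0\<close>
      by (cases m "0::int" rule: linorder_cases)
         (auto simp: q'_def pos_imp_zdiv_neg_iff pos_imp_zdiv_nonneg_iff abs_if)
    also have "\<dots> = of_int q / of_int m"
      using g by (simp add: real_of_int_div)
    finally show ?thesis .
  qed
  moreover have "coprime (int p) q' \<Longrightarrow> c / p powr (1 + \<tau>) < \<bar>t - of_int q' / of_nat p\<bar>"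
    using t p1 unfolding badly_approx_def by blast
  ultimately have far: "c / p powr (1 + \<tau>) < \<bar>t - of_int q / of_int m\<bar>"
    by simp
  have "int p * g = \<bar>m\<bar>" using g by (metis abs_mult abs_of_pos dvd_div_mult_self p_abs)
  have "int p * 1 \<le> int p * g" using g by (intro mult_left_mono) auto
  then have p_le: "int p \<le> \<bar>m\<bar>"
    using \<open>int p * g = \<bar>m\<bar>\<close> by simp
  then have p_le': "real p \<le> \<bar>of_int m\<bar>"
    by linarith
  have "R k * (\<bar>m\<bar> * \<bar>t - of_int q / of_int m\<bar>) = R k * \<bar>t * of_int m - of_int q\<bar>"
    using m by (simp add: field_simps flip: abs_mult of_int_abs)
  also have "\<dots> \<le> 1" by (rule approx)
  finally have "R k * (\<bar>m\<bar> * \<bar>t - of_int q / of_int m\<bar>) \<le> 1" .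
  moreover have "R k * (p * \<bar>t - of_int q / of_int m\<bar>) \<le> R k * (\<bar>m\<bar> * \<bar>t - of_int q / of_int m\<bar>)"
    using p_le' by (intro mult_left_mono mult_right_mono) auto
  moreover have "R k * (p * (c / p powr (1 + \<tau>))) < R k * (p * \<bar>t - of_int q / of_int m\<bar>)"
    using far p1 R_ge_2[of k] by (intro mult_strict_left_mono) auto
  ultimately have "R k * (p * (c / p powr (1 + \<tau>))) < 1" by linarith
  moreover have "R k * (p * (c / p powr (1 + \<tau>))) = R k * c / p powr \<tau>"
    using p1 by (simp add: powr_add)
  ultimately have "R k * c / p powr \<tau> < 1" by linarith
  then have "R k * c < p powr \<tau>"
    using p1 by (simp add: pos_divide_less_eq)
  also have "\<dots> \<le> M k powr \<tau>"
    using p_le m \<open>0 < \<tau>\<close> by (intro powr_mono2) linarith+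
  finally show False using M_le by (simp add: mult.commute)
qed

lemma no_solution:
  fixes t c \<tau> x y z :: real
  assumes "0 < \<tau>" "0 < c" and "\<And>k. M k powr \<tau> \<le> c * R k"
    and "t \<in> badly_approx c \<tau>" and "x \<in> E" "y \<in> E" "z \<in> E"
  shows "\<not> nontrivial_solution t x y z"
proof
  assume "nontrivial_solution t x y z"
  then have "t * x + (1 - t) * y = z" "x \<noteq> y" by (auto simp: nontrivial_solution_def)
  moreover have "0 < t" "t < 1" using assms(4) by (auto simp: badly_approx_def)
  ultimately obtain k and m q :: int
    where "m \<noteq> 0" "\<bar>m\<bar> < int (M k)" "R k * \<bar>t * of_int m - of_int q\<bar> \<le> 1"
    using assms(5-7) by (rule_tac rational_approximation[of t x y z])
  then show False
    using badly_approx_contradiction[OF assms(4,1,2,3)] by blast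
qed

end

subsection \<open>Fourier decay\<close>

text \<open>The Fourier transform of the uniform distribution on \<open>[0, 1]\<close> (with junk value \<open>0\<close> at \<open>0\<close>).\<close>

definition sinc_factor :: "real \<Rightarrow> complex" where
  "sinc_factor \<theta> = (1 - cis (- \<theta>)) / (\<i> * \<theta>)"

text \<open>Interpolates between the bound 1 near the origin and the bound
  \<open>2 / \<bar>\<theta>\<bar>\<close> away from it.\<close>

lemma norm_sinc_factor_le:
  assumes "\<theta> \<noteq> 0" "0 \<le> \<gamma>" "\<gamma> \<le> 1"
  shows "cmod (sinc_factor \<theta>) \<le> 2 * \<bar>\<theta>\<bar> powr (- \<gamma>)"
proof -
  have eq: "cmod (sinc_factor \<theta>) = cmod (1 - cis (- \<theta>)) / \<bar>\<theta>\<bar>"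
    by (simp add: sinc_factor_def norm_divide norm_mult)
  show ?thesis
  proof (cases "\<bar>\<theta>\<bar> \<le> 1")
    case True
    have "cmod (1 - cis (- \<theta>)) \<le> \<bar>\<theta>\<bar>"
      using norm_cis_diff_le[of 0 "- \<theta>"] by simp
    then have "cmod (sinc_factor \<theta>) \<le> 1"
      using assms unfolding eq by (simp add: divide_le_eq_1)
    moreover have "1 \<le> \<bar>\<theta>\<bar> powr (- \<gamma>)"
      using True assms by (simp add: powr_minus one_le_inverse_iff powr_le1)
    ultimately show ?thesis by linarith
  next
    case False
    have "cmod (1 - cis (- \<theta>)) \<le> 2"
      using norm_triangle_ineq4[of 1 "cis (- \<theta>)"] by simp
    then have "cmod (sinc_factor \<theta>) \<le> 2 * \<bar>\<theta>\<bar> powr (- 1)"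
      using assms unfolding eq by (simp add: powr_minus_divide divide_right_mono)
    also have "\<dots> \<le> 2 * \<bar>\<theta>\<bar> powr (- \<gamma>)"
      using False assms by (intro mult_left_mono powr_mono) auto
    finally show ?thesis .
  qed
qed

text \<open>A geometric series: the uniform distribution on \<open>L\<close> adjacent cells is the
  uniform distribution on one cell convolved with the \<open>L\<close> left endpoints. This relates
  the factors of consecutive levels.\<close>

lemma sinc_factor_mult:
  assumes "L \<ge> 1"
  shows "sinc_factor (real L * \<theta>) = sinc_factor \<theta> * ((\<Sum>d<L. cis (- \<theta> * real d)) / L)"
proof -
  have pow: "cis (- \<theta> * real d) = cis (- \<theta>) ^ d" for d
    by (subst Complex.DeMoivre) (simp add: mult.commute)
  have "(1 - cis (- \<theta>)) * (\<Sum>d<L. cis (- \<theta> * real d)) = 1 - cis (- \<theta>) ^ L"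
    unfolding pow by (rule one_diff_power_eq[symmetric])
  then have "(1 - cis (- \<theta>)) * (\<Sum>d<L. cis (- \<theta> * real d)) = 1 - cis (- (real L * \<theta>))"
    by (simp only: pow[symmetric]) (simp add: mult.commute)
  then show ?thesis using assms by (simp add: sinc_factor_def field_simps)
qed

text \<open>Follows from \<open>(exp z - 1) / z \<longlonglongrightarrow> 1\<close>; the second
  assumption keeps away from the default value at 0.\<close>

lemma tendsto_sinc_factor:
  assumes "(f \<longlongrightarrow> 0) F" "eventually (\<lambda>x. f x \<noteq> 0) F"
  shows "((\<lambda>x. sinc_factor (f x)) \<longlongrightarrow> 1) F"
proof -
  have "((\<lambda>z::complex. (exp z - 1) / z) \<longlongrightarrow> 1) (at 0)" by (rule lim_exp_minus_1)
  moreover have "filterlim (\<lambda>x. - \<i> * complex_of_real (f x)) (at 0) F"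
    unfolding filterlim_at
  proof
    show "\<forall>\<^sub>F x in F. - \<i> * complex_of_real (f x) \<in> UNIV \<and> - \<i> * complex_of_real (f x) \<noteq> 0"
      using assms(2) by eventually_elim simp
    have "((\<lambda>x. - \<i> * complex_of_real (f x)) \<longlongrightarrow> - \<i> * complex_of_real 0) F"
      by (intro tendsto_intros assms(1))
    then show "((\<lambda>x. - \<i> * complex_of_real (f x)) \<longlongrightarrow> 0) F" by simp
  qed
  ultimately have "((\<lambda>x. (exp (- \<i> * complex_of_real (f x)) - 1) / (- \<i> * complex_of_real (f x))) \<longlongrightarrow> 1) F"
    by (rule filterlim_compose)
  moreover have "(exp (- \<i> * complex_of_real (f x)) - 1) / (- \<i> * complex_of_real (f x)) = sinc_factor (f x)" for x
    by (simp add: sinc_factor_def cis_conv_exp divide_simps)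
  ultimately show ?thesis by simp
qed

text \<open>The unit interval is cut into \<open>N\<close> equal cells. Using \<open>frac v\<close>
  instead of \<open>v\<close> keeps the index below \<open>N\<close> on the whole line.\<close>

lemma integral_step_function:
  fixes f :: "nat \<Rightarrow> complex"
  assumes "N \<ge> 1"
  shows "(CLINT v|uniform_measure lborel {0..<1::real}. f (nat \<lfloor>frac v * N\<rfloor>)) = (\<Sum>n<N. f n) / N"
proof -
  define I where "I n = {real n / N..<(real n + 1) / N}" for n :: nat
  have I_iff: "v \<in> I n \<longleftrightarrow> nat \<lfloor>frac v * N\<rfloor> = n" if "v \<in> {0..<1}" for v n
  proof -
    have "frac v = v" using that by (simp add: frac_eq)
    moreover have "nat \<lfloor>v * N\<rfloor> = n \<longleftrightarrow> \<lfloor>v * N\<rfloor> = int n" using that by auto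
    ultimately show ?thesis
      using assms by (simp add: I_def floor_eq_iff divide_le_eq less_divide_eq)
  qed
  have less: "nat \<lfloor>frac v * N\<rfloor> < N" if "v \<in> {0..<1}" for v
  proof -
    have "frac v * N < 1 * real N"
      using frac_lt_1[of v] assms by (intro mult_strict_right_mono) auto
    then have "\<lfloor>frac v * N\<rfloor> < int N" by linarith
    then show ?thesis using assms by linarith
  qed
  have I_sub: "I n \<subseteq> {0..<1}" if "n < N" for n
  proof
    fix v assume v: "v \<in> I n"
    have "real n + 1 \<le> real N" using that by linarith
    then have "(real n + 1) / N \<le> 1" using assms by simp
    moreover have "0 \<le> real n / N" by simp
    ultimately show "v \<in> {0..<1}" using v unfolding I_def atLeastLessThan_iff by linarith
  qed
  have "(CLINT v|uniform_measure lborel {0..<1::real}. f (nat \<lfloor>frac v * N\<rfloor>))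
      = (CLINT v|lborel. indicator {0..<1} v *\<^sub>R f (nat \<lfloor>frac v * N\<rfloor>))"
  proof -
    have "uniform_measure lborel {0..<1::real} = density lborel (\<lambda>v. ennreal (indicator {0..<1} v))"
      unfolding uniform_measure_def by (intro density_cong) (auto simp: indicator_def)
    moreover have "(\<lambda>v. f (nat \<lfloor>frac v * N\<rfloor>)) \<in> borel_measurable lborel"
      unfolding frac_def by measurable
    ultimately show ?thesis by (simp add: integral_density)
  qed
  also have "\<dots> = (CLINT v|lborel. (\<Sum>n<N. indicator (I n) v *\<^sub>R f n))"
  proof (intro Bochner_Integration.integral_cong refl)
    fix v :: real
    show "indicator {0..<1} v *\<^sub>R f (nat \<lfloor>frac v * N\<rfloor>) = (\<Sum>n<N. indicator (I n) v *\<^sub>R f n)"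
    proof (cases "v \<in> {0..<1}")
      case True
      have "(\<Sum>n<N. indicator (I n) v *\<^sub>R f n) = (\<Sum>n<N. if n = nat \<lfloor>frac v * N\<rfloor> then f n else 0)"
        by (intro sum.cong refl) (auto simp: indicator_def I_iff[OF True])
      then show ?thesis using True less[OF True] by simp
    next
      case False
      then have "v \<notin> I n" if "n < N" for n using I_sub[OF that] by blast
      then show ?thesis using False by (simp add: indicator_def)
    qed
  qed
  also have "\<dots> = (\<Sum>n<N. (CLINT v|lborel. indicator (I n) v *\<^sub>R f n))"
    by (intro Bochner_Integration.integral_sum integrable_scaleR_left integrable_real_indicator)
       (auto simp: I_def divide_right_mono)
  also have "\<dots> = (\<Sum>n<N. f n / N)"
  proof (intro sum.cong refl)
    fix n
    have "integrable lborel (indicator (I n) :: real \<Rightarrow> real)"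
      by (intro integrable_real_indicator) (auto simp: I_def divide_right_mono)
    then have "(CLINT v|lborel. indicator (I n) v *\<^sub>R f n) = measure lborel (I n) *\<^sub>R f n"
      by (subst integral_scaleR_left) auto
    moreover have "measure lborel (I n) = 1 / N"
      by (simp add: I_def divide_right_mono flip: diff_divide_distrib)
    ultimately show "(CLINT v|lborel. indicator (I n) v *\<^sub>R f n) = f n / N"
      by (simp add: scaleR_conv_of_real)
  qed
  finally show ?thesis by (simp add: sum_divide_distrib)
qed

section \<open>The natural measure on the Cantor set and its Fourier transform\<close>

context cantor_scheme
begin

text \<open>The natural measure is obtained as an image of Lebesgue measure on
  \<open>{0..<1}\<close>: the \<open>n\<close>-th of \<open>N k\<close> equal cells goes to the left
  endpoint of the \<open>n\<close>-th level-\<open>k\<close> interval, and the limit in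
  \<open>k\<close> gives the map into \<open>E\<close>.\<close>

definition approx_point :: "nat \<Rightarrow> real \<Rightarrow> real" where
  "approx_point k v = A k (nat \<lfloor>frac v * N k\<rfloor>) / Q k"

definition point :: "real \<Rightarrow> real" where
  "point v = lim (\<lambda>k. approx_point k v)"

definition cantor_measure :: "real measure" where
  "cantor_measure = distr (uniform_measure lborel {0..<1}) borel point"

lemma index_less: "nat \<lfloor>frac v * N k\<rfloor> < N k"
proof -
  have "frac v * N k < 1 * real (N k)"
    using frac_lt_1[of v] N_ge_1[of k] by (intro mult_strict_right_mono) auto
  then have "\<lfloor>frac v * N k\<rfloor> < int (N k)" by linarith
  then show ?thesis using N_ge_1[of k] by linarith
qed

text \<open>Makes the cells of [0, 1) refine exactly as the intervals do, so that the points
  \<open>approx_point k v\<close> stay in a nested sequence of intervals.\<close>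

lemma index_div: "nat \<lfloor>frac v * N (Suc k)\<rfloor> div M k = nat \<lfloor>frac v * N k\<rfloor>"
proof -
  have "\<lfloor>frac v * N (Suc k)\<rfloor> div int (M k) = \<lfloor>frac v * N (Suc k) / real_of_int (int (M k))\<rfloor>"
    by (rule floor_divide_real_eq_div[symmetric]) simp
  also have "frac v * N (Suc k) / real_of_int (int (M k)) = frac v * N k"
    using M_ge_1[of k] by (simp add: N_Suc)
  finally show ?thesis
    by (metis nat_div_distrib' nat_int of_nat_0_le_iff)
qed

lemma interval_eq: "interval k n = {A k n / Q k..A k n / Q k + 1 / Q k}"
proof -
  have "A k n / Q k \<le> x \<longleftrightarrow> A k n \<le> Q k * x" "x \<le> A k n / Q k + 1 / Q k \<longleftrightarrow> Q k * x \<le> A k n + 1" for x :: real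
    by (simp_all add: pos_divide_le_eq mult.commute add.commute pos_le_divide_eq flip: add_divide_distrib)
  then show ?thesis by (auto simp: interval_def)
qed

lemma approx_point_mem: "m \<le> k \<Longrightarrow> approx_point k v \<in> interval m (nat \<lfloor>frac v * N m\<rfloor>)"
proof -
  have sub: "interval k (nat \<lfloor>frac v * N k\<rfloor>) \<subseteq> interval m (nat \<lfloor>frac v * N m\<rfloor>)" if "m \<le> k"
    using that
  proof (induction k rule: dec_induct)
    case (step k)
    then show ?case using interval_Suc_subset[of k "nat \<lfloor>frac v * N (Suc k)\<rfloor>"] unfolding index_div by blast
  qed simp
  have "approx_point k v \<in> interval k (nat \<lfloor>frac v * N k\<rfloor>)"
    by (simp add: interval_eq approx_point_def)
  then show "m \<le> k \<Longrightarrow> ?thesis" using sub by blast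
qed

lemma approx_point_tendsto: "(\<lambda>k. approx_point k v) \<longlonglongrightarrow> point v"
proof -
  have "Cauchy (\<lambda>k. approx_point k v)"
  proof (rule metric_CauchyI)
    fix e :: real assume "e > 0"
    then obtain m where m: "1 / e < 2 ^ m" using real_arch_pow[of 2 "1 / e"] by auto
    have "1 / e < Q m" using m Q_ge[of m] by (metis less_le_trans of_nat_le_iff of_nat_numeral of_nat_power)
    then have e: "1 / Q m < e" using \<open>e > 0\<close> by (simp add: field_simps)
    have "dist (approx_point k v) (approx_point l v) < e" if "k \<ge> m" "l \<ge> m" for k l
      using approx_point_mem[OF that(1), of v] approx_point_mem[OF that(2), of v] e
      unfolding interval_eq dist_real_def by auto
    then show "\<exists>m. \<forall>k\<ge>m. \<forall>l\<ge>m. dist (approx_point k v) (approx_point l v) < e" by blast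
  qed
  then show ?thesis
    unfolding point_def by (metis Cauchy_convergent convergent_LIMSEQ_iff)
qed

lemma point_mem_E: "point v \<in> E"
proof -
  have "point v \<in> interval k (nat \<lfloor>frac v * N k\<rfloor>)" for k
  proof (rule Lim_in_closed_set[OF closed_interval _ _ approx_point_tendsto])
    show "\<forall>\<^sub>F l in sequentially. approx_point l v \<in> interval k (nat \<lfloor>frac v * N k\<rfloor>)"
      using eventually_ge_at_top[of k] by eventually_elim (rule approx_point_mem)
  qed simp
  then show ?thesis using index_less by (auto simp: E_def)
qed

lemma approx_point_measurable [measurable]: "approx_point k \<in> borel_measurable borel"
  unfolding approx_point_def frac_def by measurable

lemma point_measurable [measurable]: "point \<in> borel_measurable borel"
  using approx_point_measurable approx_point_tendsto by (rule borel_measurable_LIMSEQ_metric)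

lemma prob_space_uniform: "prob_space (uniform_measure lborel {0..<1::real})"
  by (intro prob_space_uniform_measure) auto

lemma real_distribution_cantor_measure: "real_distribution cantor_measure"
proof -
  interpret U: prob_space "uniform_measure lborel {0..<1::real}" by (rule prob_space_uniform)
  show ?thesis unfolding cantor_measure_def by (intro U.real_distribution_distr) simp
qed

lemma emeasure_cantor_measure: "emeasure cantor_measure E = 1"
proof -
  interpret U: prob_space "uniform_measure lborel {0..<1::real}" by (rule prob_space_uniform)
  have "emeasure cantor_measure E = emeasure (uniform_measure lborel {0..<1}) (point -` E \<inter> UNIV)"
    unfolding cantor_measure_def using E_borel by (subst emeasure_distr) auto
  also have "point -` E = UNIV" using point_mem_E by auto
  finally show ?thesis using U.emeasure_space_1 by simp
qed

text \<open>The Fourier transform of the equidistribution on the left endpoints of level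
  \<open>k\<close>.\<close>

definition exp_sum :: "nat \<Rightarrow> real \<Rightarrow> complex" where
  "exp_sum k \<xi> = (\<Sum>n<N k. cis (- (\<xi> / Q k) * real (A k n))) / N k"

lemma exp_sum_tendsto: "(\<lambda>k. exp_sum k \<xi>) \<longlonglongrightarrow> fourier_transform cantor_measure \<xi>"
proof -
  interpret U: prob_space "uniform_measure lborel {0..<1::real}" by (rule prob_space_uniform)
  have "(\<lambda>k. CLINT v|uniform_measure lborel {0..<1}. cis (- (\<xi> * approx_point k v)))
      \<longlonglongrightarrow> (CLINT v|uniform_measure lborel {0..<1}. cis (- (\<xi> * point v)))"
    by (rule integral_dominated_convergence[where w = "\<lambda>_. 1"])
       (auto simp: cis_conv_exp intro!: tendsto_intros approx_point_tendsto AE_I2)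
  moreover have "(CLINT v|uniform_measure lborel {0..<1}. cis (- (\<xi> * approx_point k v))) = exp_sum k \<xi>" for k
    using integral_step_function[OF N_ge_1, of "\<lambda>n. cis (- (\<xi> / Q k) * real (A k n))" k]
    by (simp add: approx_point_def exp_sum_def)
  moreover have "(CLINT v|uniform_measure lborel {0..<1}. cis (- (\<xi> * point v))) = fourier_transform cantor_measure \<xi>"
    unfolding fourier_transform_def cantor_measure_def
    by (subst integral_distr) (auto simp: cis_conv_exp mult_ac)
  ultimately show ?thesis by simp
qed

text \<open>With the factor \<open>sinc_factor (\<xi> / Q k)\<close> added,
  \<open>exp_sum k \<xi>\<close> becomes the transform of the uniform measure on the
  level-\<open>k\<close> intervals. Consecutive levels then differ by the discrepancy times
  \<open>sinc_factor (\<xi> / Q (Suc k))\<close>, whose bound contributes \<open>\<bar>\<xi>\<bar>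
  powr (- \<gamma>) * Q (Suc k) powr \<gamma>\<close>. The differences telescope, and the added
  factor tends to 1.\<close>

lemma fourier_decay:
  fixes \<gamma> :: real
  assumes discrepancy: "\<And>k \<theta>. cmod ((\<Sum>m<N (Suc k). cis (- \<theta> * real (A (Suc k) m))) / N (Suc k)
        - (\<Sum>n<N k. cis (- \<theta> * real (M k * R k * A k n))) / N k
          * ((\<Sum>d<M k * R k. cis (- \<theta> * real d)) / (M k * R k)))
      \<le> B * (1 + ln (Q (Suc k))) / sqrt (N k)"
    and summable: "summable (\<lambda>k. B * (1 + ln (Q (Suc k))) / sqrt (N k) * Q (Suc k) powr \<gamma>)"
    and \<gamma>: "0 \<le> \<gamma>" "\<gamma> \<le> 1"
  shows "\<exists>C>0. \<forall>\<xi>. cmod (fourier_transform cantor_measure \<xi>) \<le> C * (1 + \<bar>\<xi>\<bar>) powr (- \<gamma>)"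
proof -
  define a where "a k = B * (1 + ln (Q (Suc k))) / sqrt (N k) * Q (Suc k) powr \<gamma>" for k
  define K where "K = 2 + 2 * (\<Sum>k. a k)"
  have disc_nonneg: "0 \<le> B * (1 + ln (Q (Suc k))) / sqrt (N k)" for k
    by (rule order_trans[OF norm_ge_zero discrepancy[where \<theta> = 0]])
  then have a_nonneg: "0 \<le> a k" for k
    unfolding a_def by (intro mult_nonneg_nonneg) auto
  have summable_a: "summable a" unfolding a_def by (rule summable)
  have K: "K \<ge> 2" unfolding K_def using suminf_nonneg[OF summable_a a_nonneg] by simp
  have large: "cmod (fourier_transform cantor_measure \<xi>) \<le> K * \<bar>\<xi>\<bar> powr (- \<gamma>)" if "\<xi> \<noteq> 0" for \<xi>
  proof -
    define T where "T k = sinc_factor (\<xi> / Q k) * exp_sum k \<xi>" for k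
    have T_step: "cmod (T (Suc k) - T k) \<le> 2 * \<bar>\<xi>\<bar> powr (- \<gamma>) * a k" for k
    proof -
      define \<theta> where "\<theta> = \<xi> / Q (Suc k)"
      have L: "M k * R k \<ge> 1" using mult_le_mono[OF M_ge_1[of k] R_ge_2[of k]] by linarith
      have \<theta>: "\<xi> / Q k = real (M k * R k) * \<theta>" using L by (simp add: \<theta>_def Q_Suc)
      have "\<theta> \<noteq> 0" using that by (simp add: \<theta>_def)
      have arg: "- (\<xi> / Q k) * real n = - \<theta> * real (M k * R k * n)" for n
        by (simp add: \<theta>)
      have T_eq: "T (Suc k) - T k = sinc_factor \<theta> * ((\<Sum>m<N (Suc k). cis (- \<theta> * real (A (Suc k) m))) / N (Suc k)
          - (\<Sum>n<N k. cis (- \<theta> * real (M k * R k * A k n))) / N k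
            * ((\<Sum>d<M k * R k. cis (- \<theta> * real d)) / (M k * R k)))"
        unfolding T_def exp_sum_def arg unfolding \<theta> sinc_factor_mult[OF L]
        by (simp add: algebra_simps flip: \<theta>_def)
      have "cmod (T (Suc k) - T k)
          \<le> (2 * \<bar>\<theta>\<bar> powr (- \<gamma>)) * (B * (1 + ln (Q (Suc k))) / sqrt (N k))"
        unfolding T_eq norm_mult
        by (rule mult_mono[OF norm_sinc_factor_le[OF \<open>\<theta> \<noteq> 0\<close> \<gamma>] discrepancy]) simp_all
      moreover have "\<bar>\<theta>\<bar> powr (- \<gamma>) = \<bar>\<xi>\<bar> powr (- \<gamma>) * Q (Suc k) powr \<gamma>"
        by (simp add: \<theta>_def powr_divide powr_minus_divide)
      ultimately show ?thesis by (simp add: a_def mult_ac)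
    qed
    have T_le: "cmod (T k) \<le> \<bar>\<xi>\<bar> powr (- \<gamma>) * (2 + 2 * (\<Sum>i<k. a i))" for k
    proof (induction k)
      case 0
      have "cmod (sinc_factor \<xi>) \<le> 2 * \<bar>\<xi>\<bar> powr (- \<gamma>)"
        using that \<gamma> by (intro norm_sinc_factor_le)
      then show ?case by (simp add: T_def exp_sum_def A_0 mult.commute)
    next
      case (Suc k)
      then show ?case using T_step[of k] norm_triangle_sub[of "T (Suc k)" "T k"]
        by (simp add: algebra_simps)
    qed
    have "cmod (T k) \<le> K * \<bar>\<xi>\<bar> powr (- \<gamma>)" for k
    proof -
      have "(\<Sum>i<k. a i) \<le> (\<Sum>k. a k)"
        using summable_a a_nonneg by (intro sum_le_suminf) auto
      then have "\<bar>\<xi>\<bar> powr (- \<gamma>) * (2 + 2 * (\<Sum>i<k. a i)) \<le> \<bar>\<xi>\<bar> powr (- \<gamma>) * K"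
        unfolding K_def by (intro mult_left_mono) auto
      then show ?thesis using T_le[of k] by (simp add: mult.commute)
    qed
    moreover have "T \<longlonglongrightarrow> 1 * fourier_transform cantor_measure \<xi>"
      unfolding T_def
    proof (intro tendsto_mult tendsto_sinc_factor exp_sum_tendsto)
      have "filterlim (\<lambda>k. real (Q k)) at_top sequentially"
      proof (rule filterlim_at_top_mono)
        show "filterlim real at_top sequentially"
          by (rule filterlim_real_sequentially)
        have "k \<le> Q k" for k using less_exp[of k] Q_ge[of k] by linarith
        then show "\<forall>\<^sub>F k in sequentially. real k \<le> real (Q k)"
          by (intro always_eventually) simp
      qed
      then show "(\<lambda>k. \<xi> / Q k) \<longlonglongrightarrow> 0"
        by (rule real_tendsto_divide_at_top[OF tendsto_const])
      show "\<forall>\<^sub>F k in sequentially. \<xi> / Q k \<noteq> 0"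
        using that Q_pos by (intro always_eventually) simp
    qed
    ultimately show ?thesis
      by (intro Lim_bounded[where M = 0 and f = "\<lambda>k. cmod (T k)"] tendsto_norm) auto
  qed
  have half: "\<bar>\<xi>\<bar> powr (- \<gamma>) \<le> 2 * (1 + \<bar>\<xi>\<bar>) powr (- \<gamma>)" if "\<bar>\<xi>\<bar> \<ge> 1" for \<xi> :: real
  proof -
    have "(1 + \<bar>\<xi>\<bar>) powr \<gamma> \<le> (2 * \<bar>\<xi>\<bar>) powr \<gamma>"
      using that \<gamma> by (intro powr_mono2) auto
    also have "\<dots> = 2 powr \<gamma> * \<bar>\<xi>\<bar> powr \<gamma>" by (simp add: powr_mult)
    also have "\<dots> \<le> 2 powr 1 * \<bar>\<xi>\<bar> powr \<gamma>"
      using \<gamma> by (intro mult_right_mono powr_mono) auto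
    finally have "(1 + \<bar>\<xi>\<bar>) powr \<gamma> \<le> 2 * \<bar>\<xi>\<bar> powr \<gamma>" by simp
    moreover have "0 < \<bar>\<xi>\<bar> powr \<gamma>" "0 < (1 + \<bar>\<xi>\<bar>) powr \<gamma>" using that by auto
    ultimately show ?thesis by (simp add: powr_minus field_simps)
  qed
  have "cmod (fourier_transform cantor_measure \<xi>) \<le> 2 * K * (1 + \<bar>\<xi>\<bar>) powr (- \<gamma>)" for \<xi>
  proof (cases "\<bar>\<xi>\<bar> \<ge> 1")
    case True
    then have "cmod (fourier_transform cantor_measure \<xi>) \<le> K * \<bar>\<xi>\<bar> powr (- \<gamma>)"
      using large[of \<xi>] by auto
    also have "\<dots> \<le> K * (2 * (1 + \<bar>\<xi>\<bar>) powr (- \<gamma>))"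
      using half[OF True] K by (intro mult_left_mono) auto
    finally show ?thesis by simp
  next
    case False
    \<comment> \<open>For \<open>\<bar>\<xi>\<bar> < 1\<close> the trivial bound 1 suffices, since
      \<open>K \<ge> 2\<close> and
      \<open>(1 + \<bar>\<xi>\<bar>) powr (- \<gamma>) \<ge> 1 / 2\<close>.\<close>
    interpret C: real_distribution cantor_measure by (rule real_distribution_cantor_measure)
    have "cmod (fourier_transform cantor_measure \<xi>) \<le> 1"
      using C.cmod_char_le_1[of "- \<xi>"] by (simp add: char_def fourier_transform_def mult_ac)
    moreover have "1 / 2 \<le> (1 + \<bar>\<xi>\<bar>) powr (- \<gamma>)"
    proof -
      have "(1 + \<bar>\<xi>\<bar>) powr \<gamma> \<le> 2 powr \<gamma>" using False \<gamma> by (intro powr_mono2) auto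
      also have "\<dots> \<le> 2 powr 1" using \<gamma> by (intro powr_mono) auto
      finally have "(1 + \<bar>\<xi>\<bar>) powr \<gamma> \<le> 2" by simp
      then show ?thesis by (simp add: powr_minus field_simps)
    qed
    moreover have "2 * 2 * (1 / 2) \<le> 2 * K * (1 + \<bar>\<xi>\<bar>) powr (- \<gamma>)"
      using K \<open>1 / 2 \<le> _\<close> by (intro mult_mono) auto
    ultimately show ?thesis by linarith
  qed
  then show ?thesis using K by (intro exI[of _ "2 * K"]) auto
qed

end

subsection \<open>The energy estimate\<close>

lemma integrable_abs_powr_unit_interval:
  fixes a :: real
  assumes "-1 < a"
  shows "integrable lborel (\<lambda>x. indicator {0..1} x * \<bar>x\<bar> powr a :: real)"
proof -
  have "(\<lambda>x. \<bar>x\<bar> powr a) integrable_on {0..1}"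
    using has_integral_powr_from_0[OF assms, of 1]
    by (intro has_integral_integrable) (auto intro: has_integral_eq)
  then have "(\<lambda>x. \<bar>x\<bar> powr a) absolutely_integrable_on {0..1}"
    by (intro nonnegative_absolutely_integrable_1) auto
  then have "integrable lebesgue (\<lambda>x. indicator {0..1} x * \<bar>x\<bar> powr a)"
    by (simp add: set_integrable_def)
  then show ?thesis
    by (subst (asm) integrable_completion) auto
qed

text \<open>The singularity at 0 is integrable because \<open>\<beta> < 1\<close>; outside [-1, 1]
  the power is at most 1 and the density itself dominates.\<close>

lemma integrable_std_normal_abs_powr:
  fixes \<beta> :: real
  assumes "0 < \<beta>" "\<beta> < 1"
  shows "integrable std_normal_distribution (\<lambda>x. \<bar>x\<bar> powr (- \<beta>))"
proof -
  define f where "f x = indicator {0..1} x * \<bar>x\<bar> powr (- \<beta>)" for x :: real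
  have f: "integrable lborel f"
    unfolding f_def using assms by (intro integrable_abs_powr_unit_interval) auto
  then have "integrable lborel (\<lambda>x. f (0 + (- 1) * x))"
    by (rule lborel_integrable_real_affine) auto
  with f have dom: "integrable lborel (\<lambda>x. f x + f (- x) + std_normal_density x)"
    by (intro Bochner_Integration.integrable_add) auto
  have "integrable lborel (\<lambda>x. std_normal_density x *\<^sub>R \<bar>x\<bar> powr (- \<beta>))"
  proof (rule Bochner_Integration.integrable_bound[OF dom])
    show "AE x in lborel. norm (std_normal_density x *\<^sub>R \<bar>x\<bar> powr (- \<beta>)) \<le> norm (f x + f (- x) + std_normal_density x)"
    proof (intro AE_I2)
      fix x :: real
      have f_nonneg: "0 \<le> f y" for y by (simp add: f_def)
      have "std_normal_density x * \<bar>x\<bar> powr (- \<beta>) \<le> f x + f (- x) + std_normal_density x"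
      proof (cases "\<bar>x\<bar> \<le> 1")
        case True
        have "1 \<le> sqrt (2 * pi)" using pi_ge_two by simp
        then have "std_normal_density x \<le> 1"
          unfolding std_normal_density_def by (intro mult_le_one) (auto simp: divide_le_eq_1)
        then have "std_normal_density x * \<bar>x\<bar> powr (- \<beta>) \<le> \<bar>x\<bar> powr (- \<beta>)"
          by (simp add: mult_left_le_one_le)
        also have "\<dots> \<le> f x + f (- x)"
          using True by (cases "0 \<le> x") (auto simp: f_def indicator_def)
        finally show ?thesis using normal_density_nonneg[of 0 1 x] by linarith
      next
        case False
        have "\<bar>x\<bar> powr (- \<beta>) \<le> \<bar>x\<bar> powr 0" using False assms by (intro powr_mono) auto
        then have "std_normal_density x * \<bar>x\<bar> powr (- \<beta>) \<le> std_normal_density x * 1"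
          using False by (intro mult_left_mono) (auto split: if_splits)
        then show ?thesis using f_nonneg[of x] f_nonneg[of "- x"] by linarith
      qed
      then show "norm (std_normal_density x *\<^sub>R \<bar>x\<bar> powr (- \<beta>)) \<le> norm (f x + f (- x) + std_normal_density x)"
        using f_nonneg by simp
    qed
  qed measurable
  then show ?thesis
    by (subst integrable_density) auto
qed

section \<open>The Gaussian energy of a measure, bounded above by Fourier decay and below by a
  cover\<close>

context real_distribution
begin

text \<open>The convolution with a Gaussian of width \<open>l\<close>, scaled to height 1 rather
  than to mass 1; its integral against \<open>M\<close> is the energy.\<close>

definition gauss_potential :: "real \<Rightarrow> real \<Rightarrow> real" where
  "gauss_potential l x = (LINT y|M. exp (- (((x - y) / l)\<^sup>2) / 2))"

lemma integrable_gauss: "integrable M (\<lambda>y. exp (- (((x - y) / l)\<^sup>2) / 2))"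
  by (rule integrable_const_bound[where B = 1]) auto

lemma gauss_potential_bounds: "0 \<le> gauss_potential l x" "gauss_potential l x \<le> 1"
proof -
  show "0 \<le> gauss_potential l x" unfolding gauss_potential_def by simp
  have "gauss_potential l x \<le> (LINT y|M. 1)"
    unfolding gauss_potential_def by (intro integral_mono integrable_gauss) auto
  then show "gauss_potential l x \<le> 1" using prob_space by simp
qed

lemma gauss_potential_measurable [measurable]: "gauss_potential l \<in> borel_measurable M"
  unfolding gauss_potential_def by measurable

lemma integrable_gauss_potential: "integrable M (gauss_potential l)"
  using gauss_potential_bounds by (intro integrable_const_bound[where B = 1]) auto

text \<open>The Gaussian kernel at \<open>x - y\<close> is the characteristic function of the
  standard normal law at \<open>(x - y) / l\<close>. Exchanging integrals twice separates
  \<open>x\<close> from \<open>y\<close> and leaves the product of \<open>char M\<close> at opposite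
  arguments.\<close>

lemma energy_identity:
  "(LINT x|M. gauss_potential l x) = (LINT g|std_normal_distribution. (cmod (char M (g / l)))\<^sup>2)"
proof -
  interpret G: real_distribution std_normal_distribution by (rule real_dist_normal_dist)
  interpret P: pair_prob_space std_normal_distribution M ..
  have gauss: "complex_of_real (exp (- (s\<^sup>2) / 2)) = (CLINT g|std_normal_distribution. iexp (s * g))" for s
    using char_std_normal_distribution by (simp add: char_def fun_eq_iff)
  have inner: "complex_of_real (gauss_potential l x)
      = (CLINT g|std_normal_distribution. iexp (x * (g / l)) * char M (- (g / l)))" for x
  proof -
    have "complex_of_real (gauss_potential l x) = (CLINT y|M. complex_of_real (exp (- (((x - y) / l)\<^sup>2) / 2)))"
      by (simp add: gauss_potential_def)
    also have "\<dots> = (CLINT y|M. CLINT g|std_normal_distribution. iexp ((x - y) / l * g))"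
      by (simp only: gauss)
    also have "\<dots> = (CLINT g|std_normal_distribution. CLINT y|M. iexp ((x - y) / l * g))"
      by (intro P.Fubini_integral P.integrable_const_bound[where B = 1]) (auto simp: case_prod_beta)
    also have "\<dots> = (CLINT g|std_normal_distribution. iexp (x * (g / l)) * char M (- (g / l)))"
    proof (intro Bochner_Integration.integral_cong refl)
      fix g
      have "iexp ((x - y) / l * g) = iexp (x * (g / l)) * iexp (- (g / l) * y)" for y
        by (simp add: exp_add[symmetric] diff_divide_distrib algebra_simps)
      then show "(CLINT y|M. iexp ((x - y) / l * g)) = iexp (x * (g / l)) * char M (- (g / l))"
        by (simp add: char_def)
    qed
    finally show ?thesis .
  qed
  have "complex_of_real (LINT x|M. gauss_potential l x) = (CLINT x|M. complex_of_real (gauss_potential l x))"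
    by simp
  also have "\<dots> = (CLINT x|M. CLINT g|std_normal_distribution. iexp (x * (g / l)) * char M (- (g / l)))"
    by (simp only: inner)
  also have "\<dots> = (CLINT g|std_normal_distribution. CLINT x|M. iexp (x * (g / l)) * char M (- (g / l)))"
    using cmod_char_le_1
    by (intro P.Fubini_integral P.integrable_const_bound[where B = 1]) (auto simp: case_prod_beta norm_mult)
  also have "\<dots> = (CLINT g|std_normal_distribution. complex_of_real ((cmod (char M (g / l)))\<^sup>2))"
  proof (intro Bochner_Integration.integral_cong refl)
    fix g
    have split: "(CLINT x|M. iexp (x * (g / l)) * char M (- (g / l))) = char M (g / l) * char M (- (g / l))"
      by (simp add: char_def mult.commute)
    have cnj: "char M (- (g / l)) = cnj (char M (g / l))"
    proof -
      have "iexp (- (g / l) * x) = cnj (iexp (g / l * x))" for x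
        by (simp add: exp_cnj)
      moreover have "integrable M (\<lambda>x. iexp (g / l * x))"
        by (rule integrable_const_bound[where B = 1]) auto
      ultimately show ?thesis
        by (simp only: char_def integral_bounded_linear[OF bounded_linear_cnj])
    qed
    show "(CLINT x|M. iexp (x * (g / l)) * char M (- (g / l))) = complex_of_real ((cmod (char M (g / l)))\<^sup>2)"
      by (rule trans[OF split]) (simp only: cnj complex_norm_square)
  qed
  also have "\<dots> = complex_of_real (LINT g|std_normal_distribution. (cmod (char M (g / l)))\<^sup>2)"
    by (simp del: of_real_power)
  finally show ?thesis by (simp only: of_real_eq_iff)
qed

text \<open>Squaring the decay and dropping the 1 bounds the integrand by
  \<open>C\<^sup>2 * \<bar>g / l\<bar> powr (- \<beta>)\<close>, from which the power of
  \<open>l\<close> splits off.\<close>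

lemma energy_le:
  assumes "0 < \<beta>" "\<beta> < 1" "0 < l"
    and decay: "\<And>\<xi>. cmod (char M \<xi>) \<le> C * (1 + \<bar>\<xi>\<bar>) powr (- \<beta> / 2)"
  shows "(LINT x|M. gauss_potential l x)
           \<le> C\<^sup>2 * (LINT g|std_normal_distribution. \<bar>g\<bar> powr (- \<beta>)) * l powr \<beta>"
proof -
  interpret G: real_distribution std_normal_distribution by (rule real_dist_normal_dist)
  have "(cmod (char M (g / l)))\<^sup>2 \<le> C\<^sup>2 * l powr \<beta> * \<bar>g\<bar> powr (- \<beta>)" if "g \<noteq> 0" for g
  proof -
    have "(cmod (char M (g / l)))\<^sup>2 \<le> (C * (1 + \<bar>g / l\<bar>) powr (- \<beta> / 2))\<^sup>2"
      using decay[of "g / l"] by (intro power_mono norm_ge_zero)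
    also have "\<dots> = C\<^sup>2 * (1 + \<bar>g / l\<bar>) powr (- \<beta>)"
      by (simp add: power_mult_distrib power2_eq_square flip: powr_add)
    also have "\<dots> \<le> C\<^sup>2 * \<bar>g / l\<bar> powr (- \<beta>)"
      using that assms by (intro mult_left_mono powr_mono2') auto
    also have "\<bar>g / l\<bar> powr (- \<beta>) = l powr \<beta> * \<bar>g\<bar> powr (- \<beta>)"
      using assms by (simp add: abs_divide powr_divide powr_minus_divide)
    finally show ?thesis by (simp add: mult.assoc)
  qed
  \<comment> \<open>At \<open>g = 0\<close> the bound fails, because \<open>powr\<close> returns 0
    there while \<open>char M 0 = 1\<close>.\<close>
  moreover have "AE g in std_normal_distribution. g \<noteq> 0"
    by (subst AE_density) (auto intro: AE_mp[OF AE_lborel_singleton])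
  ultimately have "AE g in std_normal_distribution. (cmod (char M (g / l)))\<^sup>2 \<le> C\<^sup>2 * l powr \<beta> * \<bar>g\<bar> powr (- \<beta>)"
    by auto
  then have "(LINT g|std_normal_distribution. (cmod (char M (g / l)))\<^sup>2)
      \<le> (LINT g|std_normal_distribution. C\<^sup>2 * l powr \<beta> * \<bar>g\<bar> powr (- \<beta>))"
    using assms cmod_char_le_1
    by (intro integral_mono_AE integrable_mult_right integrable_std_normal_abs_powr
          G.integrable_const_bound[where B = 1]) (auto simp: power_le_one)
  then show ?thesis by (simp add: energy_identity mult_ac)
qed

text \<open>By Cauchy-Schwarz a unit mass on \<open>N\<close> intervals has squared masses summing
  to at least \<open>1 / N\<close>. Two points of one interval of length \<open>l\<close> see each
  other with kernel at least \<open>exp (- 1 / 2)\<close>, and disjointness prevents counting a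
  point twice.\<close>

lemma energy_ge:
  fixes a :: "nat \<Rightarrow> real"
  assumes "0 < l" and disj: "disjoint_family_on (\<lambda>n. {a n..a n + l}) {..<N}"
    and "E \<in> sets M" and cover: "E \<subseteq> (\<Union>n<N. {a n..a n + l})" and full: "emeasure M E = 1"
  shows "1 \<le> N * exp (1 / 2) * (LINT x|M. gauss_potential l x)"
proof -
  define I where "I n = {a n..a n + l}" for n
  define p where "p n = prob (I n)" for n
  have I [measurable]: "I n \<in> sets M" for n by (simp add: I_def)
  have "1 = prob E" using full by (simp add: measure_def)
  also have "\<dots> \<le> prob (\<Union>n<N. I n)"
    using cover by (intro finite_measure_mono) (auto simp: I_def)
  also have "\<dots> \<le> (\<Sum>n<N. p n)"
    unfolding p_def by (intro finite_measure_subadditive_finite) (auto simp: I_def)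
  finally have "1 \<le> (\<Sum>n<N. p n)\<^sup>2" by (simp add: one_le_power)
  also have "\<dots> \<le> (\<Sum>n<N. (p n)\<^sup>2) * N"
    using sum_squared_le_sum_of_squares[of p "{..<N}"] by simp
  finally have "1 \<le> N * (\<Sum>n<N. (p n)\<^sup>2)" by (simp add: mult.commute)
  also have "(\<Sum>n<N. (p n)\<^sup>2) \<le> (\<Sum>n<N. exp (1 / 2) * (LINT x|M. indicator (I n) x * gauss_potential l x))"
  proof (intro sum_mono)
    fix n
    have p_le: "p n \<le> exp (1 / 2) * gauss_potential l x" if "x \<in> I n" for x
    proof -
      have "p n = (LINT y|M. indicator (I n) y)" by (simp add: p_def)
      also have "\<dots> \<le> (LINT y|M. exp (1 / 2) * exp (- (((x - y) / l)\<^sup>2) / 2))"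
      proof (intro integral_mono integrable_mult_right integrable_gauss integrable_real_indicator)
        fix y
        show "indicator (I n) y \<le> exp (1 / 2) * exp (- (((x - y) / l)\<^sup>2) / 2)"
        proof (cases "y \<in> I n")
          case True
          then have "\<bar>(x - y) / l\<bar> \<le> 1" using \<open>x \<in> I n\<close> \<open>0 < l\<close> by (auto simp: I_def abs_le_iff field_simps)
          then have "((x - y) / l)\<^sup>2 \<le> 1" by (simp add: abs_square_le_1)
          then show ?thesis using True by (simp add: flip: exp_add)
        qed simp
      qed (auto simp: I_def less_top[symmetric])
      finally show ?thesis by (simp add: gauss_potential_def)
    qed
    have "(p n)\<^sup>2 = (LINT x|M. indicator (I n) x * p n)"
      by (simp add: p_def power2_eq_square)
    also have "\<dots> \<le> (LINT x|M. exp (1 / 2) * (indicator (I n) x * gauss_potential l x))"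
    proof (intro integral_mono integrable_mult_right integrable_mult_left)
      show "integrable M (\<lambda>x. indicator (I n) x * gauss_potential l x)"
        using gauss_potential_bounds by (intro integrable_const_bound[where B = 1]) (auto simp: indicator_def)
      show "indicator (I n) x * p n \<le> exp (1 / 2) * (indicator (I n) x * gauss_potential l x)" for x
        using p_le[of x] by (simp add: indicator_def)
    qed (auto simp: I_def less_top[symmetric] intro!: integrable_real_indicator)
    finally show "(p n)\<^sup>2 \<le> exp (1 / 2) * (LINT x|M. indicator (I n) x * gauss_potential l x)" by simp
  qed
  also have "\<dots> = exp (1 / 2) * (LINT x|M. (\<Sum>n<N. indicator (I n) x * gauss_potential l x))"
    using gauss_potential_bounds
    by (subst Bochner_Integration.integral_sum)
       (auto simp: sum_distrib_left indicator_def intro!: integrable_const_bound[where B = 1])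
  also have "\<dots> \<le> exp (1 / 2) * (LINT x|M. gauss_potential l x)"
  proof (intro mult_left_mono integral_mono integrable_gauss_potential)
    show "integrable M (\<lambda>x. \<Sum>n<N. indicator (I n) x * gauss_potential l x)"
      using gauss_potential_bounds
      by (intro Bochner_Integration.integrable_sum integrable_const_bound[where B = 1]) (auto simp: indicator_def)
    fix x
    have "(\<Sum>n<N. indicator (I n) x) = (indicator (\<Union>n<N. I n) x :: real)"
      using disj by (intro indicator_UN_disjoint[symmetric]) (auto simp: I_def)
    then show "(\<Sum>n<N. indicator (I n) x * gauss_potential l x) \<le> gauss_potential l x"
      using gauss_potential_bounds[of l x] by (simp add: indicator_def flip: sum_distrib_right)
  qed simp
  finally show ?thesis by (simp add: mult_left_mono mult.assoc)
qed

end

subsection \<open>Choice of the parameters\<close>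

text \<open>The levels are chosen successively by \<open>exists_refinement\<close>. The bound
  \<open>B n < Q k\<close> is carried along because each refinement needs it.\<close>

lemma exists_cantor_scheme:
  fixes M R :: "nat \<Rightarrow> nat"
  assumes M: "\<And>k. M k \<ge> 1" and R: "\<And>k. R k \<ge> 2"
  defines "N \<equiv> \<lambda>k. \<Prod>i<k. M i" and "Q \<equiv> \<lambda>k. \<Prod>i<k. M i * R i"
  obtains j A where "cantor_scheme M R j A"
    and "\<And>k \<theta>. cmod ((\<Sum>m<N (Suc k). cis (- \<theta> * real (A (Suc k) m))) / N (Suc k)
        - (\<Sum>n<N k. cis (- \<theta> * real (M k * R k * A k n))) / N k
          * ((\<Sum>d<M k * R k. cis (- \<theta> * real d)) / (M k * R k)))
      \<le> 40 * (1 + ln (Q (Suc k))) / sqrt (N k)"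
proof -
  define P where "P k B \<longleftrightarrow> (k = 0 \<longrightarrow> (\<forall>n. B n = 0)) \<and> (\<forall>n<N k. B n < Q k)" for k and B :: "nat \<Rightarrow> nat"
  \<comment> \<open>The offsets are quantified inside the relation, so that dependent choice runs
    over \<open>A\<close> alone and \<open>j\<close> is extracted afterwards.\<close>
  define step where "step k B B' \<longleftrightarrow> (\<exists>j. (\<forall>n. j n < R k) \<and>
      (\<forall>m. B' m = M k * R k * B (m div M k) + (m mod M k) * R k + j (m div M k)) \<and>
      (\<forall>\<theta>. cmod ((\<Sum>m<N (Suc k). cis (- \<theta> * real (B' m))) / N (Suc k)
        - (\<Sum>n<N k. cis (- \<theta> * real (M k * R k * B n))) / N k
          * ((\<Sum>d<M k * R k. cis (- \<theta> * real d)) / (M k * R k)))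
      \<le> 40 * (1 + ln (Q (Suc k))) / sqrt (N k)))" for k and B B' :: "nat \<Rightarrow> nat"
  have N_ge_1: "N k \<ge> 1" for k unfolding N_def by (intro prod_ge_1 M)
  have N_le_Q: "N k \<le> Q k" for k
    unfolding N_def Q_def
  proof (intro prod_mono conjI)
    show "M i \<le> M i * R i" for i using R[of i] by simp
  qed simp
  have N_Suc: "N (Suc k) = N k * M k" and Q_Suc: "Q (Suc k) = Q k * (M k * R k)" for k
    by (simp_all add: N_def Q_def)
  have "\<exists>B'. P (Suc k) B' \<and> step k B B'" if "P k B" for k B
  proof -
    have B: "B n < Q k" if "n < N k" for n using \<open>P k B\<close> that by (auto simp: P_def)
    have "R k \<ge> 1" using R[of k] by simp
    obtain j where j: "\<forall>n. j n < R k"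
      and j_le: "\<forall>\<theta>. cmod ((\<Sum>m<N k * M k. cis (- \<theta> * real (M k * R k * B (m div M k) + (m mod M k) * R k + j (m div M k)))) / (N k * M k)
              - (\<Sum>n<N k. cis (- \<theta> * real (M k * R k * B n))) / N k * ((\<Sum>d<M k * R k. cis (- \<theta> * real d)) / (M k * R k)))
       \<le> 40 * (1 + ln (real (Q k * (M k * R k)))) / sqrt (N k)"
      using exists_refinement[OF N_ge_1[of k] M[of k] \<open>R k \<ge> 1\<close> N_le_Q[of k], where A = B] B by blast
    define B' where "B' m = M k * R k * B (m div M k) + (m mod M k) * R k + j (m div M k)" for m
    have "B' m < Q (Suc k)" if "m < N (Suc k)" for m
    proof -
      have "m div M k < N k" using that by (simp add: N_Suc less_mult_imp_div_less)
      then have "M k * R k * (B (m div M k) + 1) \<le> M k * R k * Q k"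
        using B by (intro mult_le_mono2) (simp add: Suc_leI)
      moreover have "(m mod M k + 1) * R k \<le> M k * R k"
        using M[of k] by (intro mult_le_mono) (auto simp: Suc_le_eq)
      moreover have "j (m div M k) < R k" using j by blast
      ultimately show ?thesis by (simp add: B'_def Q_Suc mult.commute[of "Q k"])
    qed
    then have "P (Suc k) B'" by (simp add: P_def)
    moreover have "step k B B'"
      unfolding step_def using j j_le by (intro exI[of _ j]) (simp add: B'_def N_Suc Q_Suc)
    ultimately show ?thesis by blast
  qed
  moreover have "\<exists>B. P 0 B"
    by (intro exI[of _ "\<lambda>_. 0"]) (auto simp: P_def N_def Q_def)
  ultimately obtain A where A: "\<And>k. P k (A k)" "\<And>k. step k (A k) (A (Suc k))"
    using dependent_nat_choice[of P step] by blast
  then obtain j where j: "\<And>k n. j k n < R k"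
      "\<And>k m. A (Suc k) m = M k * R k * A k (m div M k) + (m mod M k) * R k + j k (m div M k)"
    unfolding step_def by metis
  have "cantor_scheme M R j A"
    using M R j A(1)[of 0] by unfold_locales (auto simp: P_def)
  then show thesis
    using A(2) unfolding step_def by (intro that) blast+
qed

text \<open>If a measure on \<open>E\<close> decayed with exponent above \<open>s\<close>, the two
  energy estimates would bound \<open>N k * l k powr \<beta>'\<close> below by a positive constant
  for some \<open>\<beta>' > s\<close>, against \<open>small\<close>.\<close>

lemma fourier_dim_le:
  fixes E :: "real set" and s :: real
  assumes "s < 1" "0 < s" and E: "E \<in> sets borel"
    and cover: "\<And>k. E \<subseteq> (\<Union>n<N k. {a k n..a k n + l k})"
    and disj: "\<And>k. disjoint_family_on (\<lambda>n. {a k n..a k n + l k}) {..<N k}"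
    and l_pos: "\<And>k. 0 < l k"
    and small: "\<And>\<beta>. s < \<beta> \<Longrightarrow> (\<lambda>k. real (N k) * l k powr \<beta>) \<longlonglongrightarrow> 0"
  shows "fourier_dim E \<le> ereal s"
  unfolding fourier_dim_def
proof (rule SUP_least)
  fix \<beta> :: real
  assume "\<beta> \<in> {\<beta>. \<beta> \<le> 1 \<and> (\<exists>M C. real_distribution M \<and> emeasure M E = 1 \<and> C > 0 \<and>
           (\<forall>\<xi>. cmod (fourier_transform M \<xi>) \<le> C * (1 + \<bar>\<xi>\<bar>) powr (- \<beta> / 2)))}"
  then obtain M C where M: "real_distribution M" "emeasure M E = 1" and "C > 0"
    and decay: "\<And>\<xi>. cmod (fourier_transform M \<xi>) \<le> C * (1 + \<bar>\<xi>\<bar>) powr (- \<beta> / 2)"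
    by auto
  interpret real_distribution M by (rule M(1))
  show "ereal \<beta> \<le> ereal s"
  proof (rule ccontr)
    assume "\<not> ereal \<beta> \<le> ereal s"
    then have "s < min \<beta> 1" using \<open>s < 1\<close> by simp
    \<comment> \<open>The exponent is lowered below 1 so that
      \<open>\<bar>g\<bar> powr (- \<beta>')\<close> is integrable under the Gaussian.\<close>
    then obtain \<beta>' where \<beta>': "s < \<beta>'" "\<beta>' < \<beta>" "\<beta>' < 1" using dense by (metis min_less_iff_conj)
    have "0 < \<beta>'" using \<beta>' \<open>0 < s\<close> by linarith
    have decay': "cmod (char M \<xi>) \<le> C * (1 + \<bar>\<xi>\<bar>) powr (- \<beta>' / 2)" for \<xi>
    proof -
      have "cmod (char M \<xi>) \<le> C * (1 + \<bar>\<xi>\<bar>) powr (- \<beta> / 2)"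
        using decay[of "- \<xi>"] by (simp add: char_def fourier_transform_def mult_ac)
      also have "\<dots> \<le> C * (1 + \<bar>\<xi>\<bar>) powr (- \<beta>' / 2)"
        using \<open>C > 0\<close> \<beta>' by (intro mult_left_mono powr_mono) auto
      finally show ?thesis .
    qed
    define K where "K = exp (1 / 2) * (C\<^sup>2 * (LINT g|std_normal_distribution. \<bar>g\<bar> powr (- \<beta>')))"
    have ge_1: "1 \<le> K * (real (N k) * l k powr \<beta>')" for k
    proof -
      have "E \<in> sets M" using E by simp
      then have "1 \<le> N k * exp (1 / 2) * (LINT x|M. gauss_potential (l k) x)"
        by (rule energy_ge[OF l_pos disj _ cover M(2)])
      also have "\<dots> \<le> N k * exp (1 / 2) * (C\<^sup>2 * (LINT g|std_normal_distribution. \<bar>g\<bar> powr (- \<beta>')) * l k powr \<beta>')"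
        by (intro mult_left_mono energy_le[OF \<open>0 < \<beta>'\<close> \<open>\<beta>' < 1\<close> l_pos decay']) auto
      finally show ?thesis by (simp add: K_def mult_ac)
    qed
    have "(\<lambda>k. K * (real (N k) * l k powr \<beta>')) \<longlonglongrightarrow> K * 0"
      by (intro tendsto_mult tendsto_const small \<beta>')
    then have "1 \<le> K * 0"
      using ge_1 by (intro LIMSEQ_le_const) auto
    then show False by simp
  qed
qed

text \<open>Once \<open>\<eta> * k \<ge> \<bar>b\<bar> + \<bar>d\<bar> + 1\<close>, the exponent is
  at most \<open>- k\<close> and a geometric series dominates.\<close>

lemma summable_of_quadratic_exponent:
  fixes f :: "nat \<Rightarrow> real"
  assumes "\<eta> > 0" and f: "\<And>k. 0 \<le> f k" "\<And>k. f k \<le> C * 2 powr (b + d * real k - \<eta> * (real k)\<^sup>2)"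
  shows "summable f"
proof -
  have "summable (\<lambda>k. \<bar>C\<bar> * (1 / 2) ^ k :: real)"
    by (intro summable_mult summable_geometric) simp
  moreover have "\<forall>\<^sub>F k in sequentially. norm (f k) \<le> \<bar>C\<bar> * (1 / 2) ^ k"
    using eventually_ge_at_top[of "nat \<lceil>(\<bar>b\<bar> + \<bar>d\<bar> + 1) / \<eta>\<rceil> + 1"]
  proof eventually_elim
    case (elim k)
    then have k: "(\<bar>b\<bar> + \<bar>d\<bar> + 1) / \<eta> \<le> real k" "1 \<le> real k" by linarith+
    then have "\<bar>b\<bar> + \<bar>d\<bar> + 1 \<le> \<eta> * real k" using \<open>\<eta> > 0\<close> by (simp add: pos_divide_le_eq mult.commute)
    then have "(\<bar>b\<bar> + \<bar>d\<bar> + 1) * real k \<le> \<eta> * real k * real k" by (intro mult_right_mono) auto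
    moreover have "b \<le> \<bar>b\<bar> * real k" using k(2) by (smt (verit) mult_left_le mult_le_cancel_left1)
    moreover have "d * real k \<le> \<bar>d\<bar> * real k" by (intro mult_right_mono) auto
    ultimately have "b + d * real k - \<eta> * (real k)\<^sup>2 \<le> - real k"
      by (simp add: power2_eq_square algebra_simps)
    then have "2 powr (b + d * real k - \<eta> * (real k)\<^sup>2) \<le> 2 powr (- real k)" by simp
    also have "2 powr (- real k) = (1 / 2) ^ k"
      by (simp add: powr_minus powr_realpow power_one_over inverse_eq_divide)
    finally have "\<bar>C\<bar> * 2 powr (b + d * real k - \<eta> * (real k)\<^sup>2) \<le> \<bar>C\<bar> * (1 / 2) ^ k"
      by (intro mult_left_mono) auto
    moreover have "f k \<le> \<bar>C\<bar> * 2 powr (b + d * real k - \<eta> * (real k)\<^sup>2)"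
      using f(2)[of k] by (rule order_trans) (intro mult_right_mono, auto)
    ultimately show ?case using f(1)[of k] by simp
  qed
  ultimately show ?thesis by (rule summable_comparison_test_ev[rotated])
qed

lemma prod_powers_of_two: "real (\<Prod>i<k. 2 ^ Suc i) = 2 powr (real k * (real k + 1) / 2)"
proof (induction k)
  case (Suc k)
  have "(2::real) ^ Suc k = 2 powr (real k + 1)"
    by (metis of_nat_Suc add.commute powr_realpow zero_less_numeral)
  then have "real (\<Prod>i<Suc k. 2 ^ Suc i) = 2 powr (real k * (real k + 1) / 2) * 2 powr (real k + 1)"
    using Suc by simp
  also have "\<dots> = 2 powr (real k * (real k + 1) / 2 + (real k + 1))" by (rule powr_add[symmetric])
  also have "real k * (real k + 1) / 2 + (real k + 1) = real (Suc k) * (real (Suc k) + 1) / 2"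
    by (simp add: field_simps)
  finally show ?case .
qed simp

theorem theorem1p8:
  fixes \<tau> c \<epsilon>\<^sub>0 :: real
  assumes "0 < \<tau>" "\<tau> \<le> 1" "0 < c" "c \<le> 1"
    and "0 < \<epsilon>\<^sub>0" "\<epsilon>\<^sub>0 < 1/2"
  shows "\<exists>E. E \<subseteq> {0..1} \<and> E \<in> sets borel \<and>
           fourier_dim E = ereal (1 / (1 + \<tau>)) \<and>
           (\<forall>t \<in> badly_approx c \<tau> \<inter> {\<epsilon>\<^sub>0<..<1 - \<epsilon>\<^sub>0}.
              \<not> (\<exists>x\<in>E. \<exists>y\<in>E. \<exists>z\<in>E. nontrivial_solution t x y z))"
proof -
  \<comment> \<open>Slow growth: \<open>N k\<close> is \<open>2 powr (k * (k + 1) / 2)\<close>, so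
    both \<open>M k\<close> and any \<open>D ^ k\<close> are negligible powers of
    \<open>N k\<close>.\<close>
  define M :: "nat \<Rightarrow> nat" where "M k = 2 ^ Suc k" for k
  \<comment> \<open>The order \<open>M k powr \<tau> / c\<close> contradicts bad approximability;
    the factor 2 ensures \<open>R k \<ge> 2\<close>, as \<open>M k powr \<tau> \<ge> 1\<close> and
    \<open>c \<le> 1\<close>.\<close>
  define R :: "nat \<Rightarrow> nat" where "R k = nat \<lceil>2 * M k powr \<tau> / c\<rceil>" for k
  \<comment> \<open>The 3 is the 2 from \<open>R\<close> plus 1 for the rounding up.\<close>
  define D where "D = 3 / c"
  define s where "s = 1 / (1 + \<tau>)"
  have s: "0 < s" "s < 1" and D: "1 \<le> D"
    using assms by (auto simp: s_def D_def field_simps)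
  have M_ge_1: "M k \<ge> 1" for k unfolding M_def by (rule one_le_power) simp
  have M_powr: "1 \<le> M k powr \<tau>" for k
    using M_ge_1[of k] assms by (intro ge_one_powr_ge_zero) auto
  have R_ge: "2 * M k powr \<tau> / c \<le> R k" for k
    unfolding R_def by linarith
  have ge_2: "2 * M k powr \<tau> \<le> 2 * M k powr \<tau> / c" for k
  proof -
    have "2 * M k powr \<tau> * c \<le> 2 * M k powr \<tau>"
      using \<open>c \<le> 1\<close> by (intro mult_left_le) auto
    then show ?thesis using \<open>0 < c\<close> by (simp add: pos_le_divide_eq)
  qed
  have R_powr: "M k powr \<tau> \<le> R k" for k
    using R_ge[of k] ge_2[of k] M_powr[of k] by linarith
  have R_ge_2: "R k \<ge> 2" for k
    using R_ge[of k] ge_2[of k] M_powr[of k] by linarith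
  have R_le: "R k \<le> D * M k powr \<tau>" for k
  proof -
    have "0 \<le> 2 * M k powr \<tau> / c" using \<open>0 < c\<close> by simp
    then have "R k \<le> 2 * M k powr \<tau> / c + 1"
      unfolding R_def by linarith
    also have "1 \<le> M k powr \<tau> / c" using ge_2[of k] M_powr[of k] by linarith
    finally show ?thesis by (simp add: D_def add_divide_distrib[symmetric])
  qed
  obtain j A where scheme: "cantor_scheme M R j A"
    and discrepancy: "\<And>k \<theta>. cmod ((\<Sum>m<\<Prod>i<Suc k. M i. cis (- \<theta> * real (A (Suc k) m))) / (\<Prod>i<Suc k. M i)
        - (\<Sum>n<\<Prod>i<k. M i. cis (- \<theta> * real (M k * R k * A k n))) / (\<Prod>i<k. M i)
          * ((\<Sum>d<M k * R k. cis (- \<theta> * real d)) / (M k * R k)))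
      \<le> 40 * (1 + ln (\<Prod>i<Suc k. M i * R i)) / sqrt (\<Prod>i<k. M i)"
    by (rule exists_cantor_scheme[of M R, OF M_ge_1 R_ge_2]) blast
  interpret cantor_scheme M R j A by (rule scheme)
  have N_eq: "N k = 2 powr (real k * (real k + 1) / 2)" for k
    unfolding N_def M_def by (rule prod_powers_of_two)
  have N_pos: "0 < real (N k)" and Q_pos': "0 < real (Q k)" for k
    using N_ge_1[of k] by auto
  \<comment> \<open>With \<open>Q_upper\<close> this shows that \<open>N k\<close> is
    \<open>Q k\<close> to the power \<open>s + o(1)\<close>, which gives both dimension
    bounds.\<close>
  have Q_lower: "N k powr (1 + \<tau>) \<le> Q k" for k
  proof (induction k)
    case (Suc k)
    have "N (Suc k) powr (1 + \<tau>) = N k powr (1 + \<tau>) * (M k * M k powr \<tau>)"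
      using M_ge_1[of k] by (simp add: N_Suc powr_mult powr_add)
    also have "\<dots> \<le> real (Q k) * (real (M k) * real (R k))"
      using Suc R_powr by (intro mult_mono) auto
    finally show ?case by (simp add: Q_Suc)
  qed simp
  have Q_upper: "Q k \<le> D ^ k * N k powr (1 + \<tau>)" for k
  proof (induction k)
    case (Suc k)
    have "real (Q (Suc k)) = real (Q k) * (real (M k) * real (R k))" by (simp add: Q_Suc)
    also have "\<dots> \<le> (D ^ k * N k powr (1 + \<tau>)) * (M k * (D * M k powr \<tau>))"
      using Suc R_le D by (intro mult_mono) auto
    also have "\<dots> = D ^ Suc k * N (Suc k) powr (1 + \<tau>)"
      using M_ge_1[of k] by (simp add: N_Suc powr_mult powr_add mult_ac)
    finally show ?case .
  qed simp
  have upper: "fourier_dim E \<le> ereal s"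
  proof (rule fourier_dim_le[OF s(2,1) E_borel, where N = N and a = "\<lambda>k n. A k n / Q k" and l = "\<lambda>k. 1 / Q k"])
    show "E \<subseteq> (\<Union>n<N k. {A k n / Q k..A k n / Q k + 1 / Q k})" for k
      unfolding E_def interval_eq by blast
    show "disjoint_family_on (\<lambda>n. {A k n / Q k..A k n / Q k + 1 / Q k}) {..<N k}" for k
      unfolding disjoint_family_on_def interval_eq[symmetric] using interval_unique by blast
    show "0 < 1 / real (Q k)" for k by simp
    fix \<beta> assume "s < \<beta>"
    then have neg: "1 - \<beta> * (1 + \<tau>) < 0" using assms by (simp add: s_def field_simps)
    have "0 < \<beta>" using \<open>s < \<beta>\<close> s by linarith
    have N_top: "filterlim (\<lambda>k. real (N k)) at_top sequentially"
    proof (rule filterlim_at_top_mono)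
      show "filterlim real at_top sequentially" by (rule filterlim_real_sequentially)
      have "real k \<le> N k" for k
      proof (cases k)
        case (Suc m)
        have "k < 2 ^ k" by (rule less_exp)
        also have "2 ^ k = M m" by (simp add: M_def Suc)
        also have "\<dots> \<le> N k" using N_ge_1[of m] by (simp add: N_Suc Suc)
        finally show ?thesis by simp
      qed simp
      then show "\<forall>\<^sub>F k in sequentially. real k \<le> real (N k)" by (intro always_eventually) simp
    qed
    show "(\<lambda>k. real (N k) * (1 / real (Q k)) powr \<beta>) \<longlonglongrightarrow> 0"
    proof (rule tendsto_sandwich[OF _ _ tendsto_const tendsto_neg_powr[OF neg N_top]])
      show "\<forall>\<^sub>F k in sequentially. real (N k) * (1 / real (Q k)) powr \<beta> \<le> N k powr (1 - \<beta> * (1 + \<tau>))"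
      proof (intro always_eventually allI)
        fix k
        have "(1 / real (Q k)) powr \<beta> \<le> (1 / N k powr (1 + \<tau>)) powr \<beta>"
          using Q_lower[of k] N_pos[of k] \<open>0 < \<beta>\<close> by (intro powr_mono2 divide_left_mono mult_pos_pos) auto
        also have "\<dots> = N k powr (- (\<beta> * (1 + \<tau>)))"
          using N_pos[of k] by (simp add: powr_divide powr_powr powr_minus_divide mult.commute)
        finally have "real (N k) * (1 / real (Q k)) powr \<beta> \<le> N k powr 1 * N k powr (- (\<beta> * (1 + \<tau>)))"
          using N_pos[of k] by (simp add: mult_left_mono)
        then show "real (N k) * (1 / real (Q k)) powr \<beta> \<le> N k powr (1 - \<beta> * (1 + \<tau>))"
          unfolding powr_add[symmetric] by simp
      qed
    qed (auto intro!: always_eventually)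
  qed
  have summable: "summable (\<lambda>k. 40 * (1 + ln (Q (Suc k))) / sqrt (N k) * Q (Suc k) powr \<gamma>)"
    if "0 < \<gamma>" "2 * \<gamma> < s" for \<gamma>
  proof -
    \<comment> \<open>Half of the room between \<open>\<gamma>\<close> and \<open>s / 2\<close>
      absorbs the logarithm into \<open>Q (Suc k) powr \<delta>\<close> and still leaves
      \<open>\<gamma>' < s / 2\<close>.\<close>
    define \<delta> where "\<delta> = (s / 2 - \<gamma>) / 2"
    define \<gamma>' where "\<gamma>' = \<gamma> + \<delta>"
    define r where "r = \<gamma>' * (1 + \<tau>)"
    define d where "d = \<gamma>' * log 2 D"
    have \<delta>: "0 < \<delta>" and \<gamma>': "0 < \<gamma>'" "\<gamma>' < s / 2"
      using that by (auto simp: \<delta>_def \<gamma>'_def field_simps)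
    \<comment> \<open>To leading order in the exponent, \<open>Q (Suc k) powr \<gamma>'\<close> is
      \<open>2 powr (r * k\<^sup>2 / 2)\<close> and \<open>1 / sqrt (N k)\<close> is
      \<open>2 powr (- k\<^sup>2 / 4)\<close>; \<open>r < 1 / 2\<close> makes the second
      win.\<close>
    have r: "r < 1 / 2" using \<gamma>' assms by (simp add: r_def s_def field_simps)
    show ?thesis
    proof (rule summable_of_quadratic_exponent[where \<eta> = "1 / 4 - r / 2" and C = "40 * (1 + 1 / \<delta>)"
          and b = "d + r" and d = "d + 3 * r / 2 - 1 / 4"])
      show "0 < 1 / 4 - r / 2" using r by simp
      fix k
      have Q1: "1 \<le> real (Q (Suc k))" using Q_pos[of "Suc k"] by linarith
      show "0 \<le> 40 * (1 + ln (Q (Suc k))) / sqrt (N k) * Q (Suc k) powr \<gamma>"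
        using ln_ge_zero[OF Q1] by simp
      have "1 + ln (Q (Suc k)) \<le> Q (Suc k) powr \<delta> + Q (Suc k) powr \<delta> / \<delta>"
        using ln_powr_bound[OF Q1 \<delta>] ge_one_powr_ge_zero[OF Q1, of \<delta>] \<delta> by linarith
      then have "(1 + ln (Q (Suc k))) * Q (Suc k) powr \<gamma>
          \<le> (Q (Suc k) powr \<delta> + Q (Suc k) powr \<delta> / \<delta>) * Q (Suc k) powr \<gamma>"
        by (rule mult_right_mono) simp
      also have "\<dots> = (1 + 1 / \<delta>) * Q (Suc k) powr \<gamma>'"
        by (simp add: \<gamma>'_def powr_add algebra_simps)
      also have "\<dots> \<le> (1 + 1 / \<delta>) * 2 powr (d * (real k + 1) + r * ((real k + 1) * (real k + 2) / 2))"
      proof (intro mult_left_mono)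
        have D_pow: "D ^ Suc k = D powr (real k + 1)"
          using powr_realpow[of D "Suc k"] D by (simp only: of_nat_Suc add.commute)
        have "Q (Suc k) powr \<gamma>' \<le> (D ^ Suc k * N (Suc k) powr (1 + \<tau>)) powr \<gamma>'"
          using Q_upper[of "Suc k"] \<gamma>' by (intro powr_mono2) auto
        also have "\<dots> = (D powr (real k + 1)) powr \<gamma>' * (N (Suc k) powr (1 + \<tau>)) powr \<gamma>'"
          unfolding D_pow using D by (simp add: powr_mult)
        also have "D = 2 powr (log 2 D)" using D by simp
        also have "((2 powr (log 2 D)) powr (real k + 1)) powr \<gamma>' = 2 powr (d * (real k + 1))"
          by (simp add: powr_powr d_def mult_ac)
        also have "(N (Suc k) powr (1 + \<tau>)) powr \<gamma>' = 2 powr (r * ((real k + 1) * (real k + 2) / 2))"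
          unfolding N_eq by (simp add: powr_powr r_def mult_ac add.commute)
        finally show "Q (Suc k) powr \<gamma>' \<le> 2 powr (d * (real k + 1) + r * ((real k + 1) * (real k + 2) / 2))"
          by (simp add: powr_add)
      qed (use \<delta> in simp)
      finally have main: "(1 + ln (Q (Suc k))) * Q (Suc k) powr \<gamma>
          \<le> (1 + 1 / \<delta>) * 2 powr (d * (real k + 1) + r * ((real k + 1) * (real k + 2) / 2))" .
      have sqrt_eq: "1 / sqrt (N k) = 2 powr (- (real k * (real k + 1) / 4))"
        unfolding N_eq by (simp add: powr_half_sqrt[symmetric] powr_powr powr_minus_divide)
      have "40 * (1 + ln (Q (Suc k))) / sqrt (N k) * Q (Suc k) powr \<gamma>
          = 40 * ((1 + ln (Q (Suc k))) * Q (Suc k) powr \<gamma>) * (1 / sqrt (N k))"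
        by simp
      also have "\<dots> \<le> 40 * ((1 + 1 / \<delta>) * 2 powr (d * (real k + 1) + r * ((real k + 1) * (real k + 2) / 2)))
          * (1 / sqrt (N k))"
        using main by (intro mult_right_mono mult_left_mono) auto
      also have "\<dots> = 40 * (1 + 1 / \<delta>) * 2 powr (d * (real k + 1) + r * ((real k + 1) * (real k + 2) / 2)
              + - (real k * (real k + 1) / 4))"
        unfolding sqrt_eq powr_add by (simp only: mult_ac)
      also have "d * (real k + 1) + r * ((real k + 1) * (real k + 2) / 2) + - (real k * (real k + 1) / 4)
          = d + r + (d + 3 * r / 2 - 1 / 4) * real k - (1 / 4 - r / 2) * (real k)\<^sup>2"
        by (simp add: field_simps power2_eq_square)
      finally show "40 * (1 + ln (Q (Suc k))) / sqrt (N k) * Q (Suc k) powr \<gamma>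
          \<le> 40 * (1 + 1 / \<delta>) * 2 powr (d + r + (d + 3 * r / 2 - 1 / 4) * real k - (1 / 4 - r / 2) * (real k)\<^sup>2)" .
    qed
  qed
  have lower: "ereal s \<le> fourier_dim E"
  proof (rule dense_le)
    fix y assume y: "y < ereal s"
    show "y \<le> fourier_dim E"
    proof (cases y)
      case (real r)
      \<comment> \<open>The maximum keeps the exponent positive when \<open>r\<close> is not;
        \<open>fourier_decay\<close> is then applied with
        \<open>\<gamma> = \<beta> / 2\<close>.\<close>
      define \<beta> where "\<beta> = max r (s / 2)"
      have \<beta>: "0 < \<beta>" "\<beta> < s" using y s by (auto simp: \<beta>_def real)
      have "\<exists>C>0. \<forall>\<xi>. cmod (fourier_transform cantor_measure \<xi>) \<le> C * (1 + \<bar>\<xi>\<bar>) powr (- (\<beta> / 2))"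
        using \<beta> s discrepancy by (intro fourier_decay[where B = 40] summable) (auto simp: N_def Q_def)
      then have "ereal \<beta> \<le> fourier_dim E"
        unfolding fourier_dim_def using \<beta> s real_distribution_cantor_measure emeasure_cantor_measure
        by (intro SUP_upper) auto
      moreover have "y \<le> ereal \<beta>" by (simp add: real \<beta>_def)
      ultimately show ?thesis by (rule order_trans[rotated])
    qed (use y in auto)
  qed
  have "\<not> nontrivial_solution t x y z"
    if "t \<in> badly_approx c \<tau>" "x \<in> E" "y \<in> E" "z \<in> E" for t x y z
  proof (rule no_solution[OF \<open>0 < \<tau>\<close> \<open>0 < c\<close> _ that])
    show "M k powr \<tau> \<le> c * R k" for k
      using R_ge[of k] M_powr[of k] \<open>0 < c\<close> by (simp add: pos_divide_le_eq mult.commute)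
  qed
  then show ?thesis
    using E_subset E_borel upper lower by (intro exI[of _ E]) (auto simp: s_def)
qed

end
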